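(* Let $P$ be a finite simplicial poset and let $\mathbf k$ be a field. Then there is a ring isomorphism $$\mathcal R(P)\cong A_P ,$$ i.e. the Stanley--Reisner ring $\mathcal R(P)$ (defined as a ring of global sections) recovers Stanley's face ring $A_P$ of $P$.
   Context: A simplicial poset is a countable poset $P$ of finite length with a unique minimal element $\hat 0$ such that for every $p\in P$ the lower interval $P_{\leq p}=\{x\in P\mid x\le p\}$ is a (finite) Boolean algebra. $A(P)$ denotes the set of atoms of $P$ (elements covering $\hat 0$) and $\max(P)$ the set of maximal elements. Definition of $\mathcal R(P)$. If $\mathfrak a$ is a nonempty lower order ideal of $P$ contained in some $P_{\leq p}$, then $\mathfrak a$ is the face poset of a simplicial complex with vertex set $A(P)\cap\mathfrak a$ (an element of $\mathfrak a$ corresponds to the set of atoms below it). Its Stanley--Reisner ring is $R_{\mathfrak a}=\mathbf k[x_v\mid v\in A(P)\cap \mathfrak a]/(\prod_{v\in\sigma}x_v \mid \sigma\subseteq A(P)\cap\mathfrak a$ is not the set of atoms below an element of $\mathfrak a)$. For a nonempty $\tau\subseteq\max(P)$ put $\lceil\tau\rceil=\bigcap_{t\in\tau}P_{\leq t}$, and let $X(P)=\{\lceil\tau\rceil\mid \emptyset\neq\tau\subseteq\max(P)\}$. For $\mathfrak a\supseteq\mathfrak b$ in $X(P)$ let $\pi^{\mathfrak a}_{\mathfrak b}:R_{\mathfrak a}\to R_{\mathfrak b}$ be the natural projection ($x_v\mapsto x_v$ if $v\in\mathfrak b$, $x_v\mapsto 0$ otherwise). Then $\mathcal R(P)$ is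 the ring of all tuples $(q_{\mathfrak a})_{\mathfrak a\in X(P)}$ with $q_{\mathfrak a}\in R_{\mathfrak a}$ and $\pi^{\mathfrak a}_{\mathfrak b}(q_{\mathfrak a})=q_{\mathfrak b}$ whenever $\mathfrak a\supseteq\mathfrak b$, with componentwise operations. Definition of $A_P$ (for finite $P$). Let $\widetilde S=\mathbf k[x_p\mid p\in P]$ and $S=\widetilde S/(x_{\hat 0}-1)$. For $p,q\in P$ let $u(p,q)$ be the (possibly empty) set of minimal common upper bounds of $p$ and $q$ in $P$. Let $I_P$ be the ideal of $S$ generated by the elements $x_px_q-x_{p\wedge q}\sum_{z\in u(p,q)}x_z$ for all incomparable $p,q\in P$ (with $x_{\hat 0}=1$); if $u(p,q)=\emptyset$, the generator is just $x_px_q$ (if $u(p,q)\neq\emptyset$ the meet $p\wedge q$ exists). Then $A_P=S/I_P$. *)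

theory Defs
  imports
    "HOL-Algebra.Algebra"
    "HOL-Algebra.Algebraic_Closure_Type"
    "HOL-Library.Poly_Mapping"
    "HOL-Library.Countable_Set"
begin

section \<open>Simplicial posets\<close>

definition boolean_algebra_on :: "('a, 'b) gorder_scheme \<Rightarrow> bool" where
  "boolean_algebra_on L \<longleftrightarrow>
     bounded_lattice L \<and>
     (\<forall>x\<in>carrier L. \<forall>y\<in>carrier L. \<forall>z\<in>carrier L.
        x \<sqinter>\<^bsub>L\<^esub> (y \<squnion>\<^bsub>L\<^esub> z) = (x \<sqinter>\<^bsub>L\<^esub> y) \<squnion>\<^bsub>L\<^esub> (x \<sqinter>\<^bsub>L\<^esub> z)) \<and>
     (\<forall>x\<in>carrier L. \<exists>y\<in>carrier L. x \<squnion>\<^bsub>L\<^esub> y = \<top>\<^bsub>L\<^esub> \<and> x \<sqinter>\<^bsub>L\<^esub> y = \<bottom>\<^bsub>L\<^esub>)"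

definition finite_length :: "('a, 'b) gorder_scheme \<Rightarrow> bool" where
  "finite_length P \<longleftrightarrow>
     (\<exists>n. \<forall>C. C \<subseteq> carrier P \<and> Complete_Partial_Order.chain (\<sqsubseteq>\<^bsub>P\<^esub>) C \<longrightarrow> finite C \<and> card C \<le> n)"

definition minimal_elements :: "('a, 'b) gorder_scheme \<Rightarrow> 'a set \<Rightarrow> 'a set" where
  "minimal_elements P A = {x \<in> A. \<forall>y\<in>A. y \<sqsubseteq>\<^bsub>P\<^esub> x \<longrightarrow> y = x}"

definition maximal_elements :: "('a, 'b) gorder_scheme \<Rightarrow> 'a set \<Rightarrow> 'a set" where
  "maximal_elements P A = {x \<in> A. \<forall>y\<in>A. x \<sqsubseteq>\<^bsub>P\<^esub> y \<longrightarrow> y = x}"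

definition lower_interval :: "('a, 'b) gorder_scheme \<Rightarrow> 'a \<Rightarrow> 'a set" where
  "lower_interval P p = {x \<in> carrier P. x \<sqsubseteq>\<^bsub>P\<^esub> p}"

definition simplicial_poset :: "('a, 'b) gorder_scheme \<Rightarrow> bool" where
  "simplicial_poset P \<longleftrightarrow>
     partial_order P \<and> countable (carrier P) \<and> finite_length P \<and>
     (\<exists>!z. z \<in> minimal_elements P (carrier P)) \<and>
     (\<forall>p\<in>carrier P. finite (lower_interval P p) \<and>
        boolean_algebra_on (P\<lparr>carrier := lower_interval P p\<rparr>))"

definition zero_hat :: "('a, 'b) gorder_scheme \<Rightarrow> 'a" where
  "zero_hat P = (THE z. z \<in> minimal_elements P (carrier P))"

definition atoms :: "('a, 'b) gorder_scheme \<Rightarrow> 'a set" where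
  "atoms P = {v \<in> carrier P. zero_hat P \<sqsubset>\<^bsub>P\<^esub> v \<and>
     \<not> (\<exists>x\<in>carrier P. zero_hat P \<sqsubset>\<^bsub>P\<^esub> x \<and> x \<sqsubset>\<^bsub>P\<^esub> v)}"

definition atoms_below :: "('a, 'b) gorder_scheme \<Rightarrow> 'a \<Rightarrow> 'a set" where
  "atoms_below P x = {v \<in> atoms P. v \<sqsubseteq>\<^bsub>P\<^esub> x}"


section \<open>Polynomial rings in a set of variables\<close>

text \<open>
  A polynomial is a finitely supported function from monomials to coefficients, and a monomial
  is a finitely supported function from variables to exponents. The argument of type
  \<open>'k itself\<close> names the coefficient field.
\<close>

type_synonym ('v, 'k) mpoly = "('v \<Rightarrow>\<^sub>0 nat) \<Rightarrow>\<^sub>0 'k"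

definition mvar :: "'v \<Rightarrow> ('v, 'k::field) mpoly" where
  "mvar v = Poly_Mapping.single (Poly_Mapping.single v 1) 1"

definition mconst :: "'k \<Rightarrow> ('v, 'k::field) mpoly" where
  "mconst c = Poly_Mapping.single 0 c"

definition msubst :: "('v \<Rightarrow> ('w, 'k) mpoly) \<Rightarrow> ('v, 'k::field) mpoly \<Rightarrow> ('w, 'k) mpoly" where
  "msubst g f = (\<Sum>m\<in>Poly_Mapping.keys f. mconst (Poly_Mapping.lookup f m) *
     (\<Prod>v\<in>Poly_Mapping.keys m. g v ^ Poly_Mapping.lookup m v))"

definition mpoly_ring :: "'k::field itself \<Rightarrow> 'v set \<Rightarrow> ('v, 'k) mpoly ring" where
  "mpoly_ring k V = ring_of_type_algebra
     \<lparr>carrier := {f. \<forall>m\<in>Poly_Mapping.keys f. Poly_Mapping.keys m \<subseteq> V}\<rparr>"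


section \<open>The ring of global sections\<close>

definition SR_ideal :: "'k::field itself \<Rightarrow> ('a, 'b) gorder_scheme \<Rightarrow> 'a set \<Rightarrow> ('a, 'k) mpoly set" where
  "SR_ideal k P \<aa> = Idl\<^bsub>mpoly_ring k (atoms P \<inter> \<aa>)\<^esub>
     {\<Prod>v\<in>\<sigma>. mvar v | \<sigma>. \<sigma> \<subseteq> atoms P \<inter> \<aa> \<and> \<sigma> \<notin> atoms_below P ` \<aa>}"

definition SR_ring :: "'k::field itself \<Rightarrow> ('a, 'b) gorder_scheme \<Rightarrow> 'a set \<Rightarrow> ('a, 'k) mpoly set ring" where
  "SR_ring k P \<aa> = mpoly_ring k (atoms P \<inter> \<aa>) Quot SR_ideal k P \<aa>"

definition ideal_meet :: "('a, 'b) gorder_scheme \<Rightarrow> 'a set \<Rightarrow> 'a set" where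
  "ideal_meet P \<tau> = (\<Inter>t\<in>\<tau>. lower_interval P t)"

definition max_intersections :: "('a, 'b) gorder_scheme \<Rightarrow> 'a set set" where
  "max_intersections P =
     {ideal_meet P \<tau> | \<tau>. \<tau> \<noteq> {} \<and> \<tau> \<subseteq> maximal_elements P (carrier P)}"

text \<open>
  The projection is induced by substitution on representatives. The substitution is constant
  modulo the target ideal on each coset when \<open>\<bb> \<subseteq> \<aa>\<close>, so \<^const>\<open>the_elem\<close> is applied to a singleton.
\<close>

definition SR_proj ::
    "'k::field itself \<Rightarrow> ('a, 'b) gorder_scheme \<Rightarrow> 'a set \<Rightarrow> 'a set \<Rightarrow> ('a, 'k) mpoly set \<Rightarrow> ('a, 'k) mpoly set" where
  "SR_proj k P \<aa> \<bb> C = the_elem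
     ((\<lambda>f. SR_ideal k P \<bb> +>\<^bsub>mpoly_ring k (atoms P \<inter> \<bb>)\<^esub>
        msubst (\<lambda>v. if v \<in> \<bb> then mvar v else 0) f) ` C)"

definition sections_ring :: "'k::field itself \<Rightarrow> ('a, 'b) gorder_scheme \<Rightarrow> ('a set \<Rightarrow> ('a, 'k) mpoly set) ring" where
  "sections_ring k P =
     \<lparr>carrier = {q \<in> \<Pi>\<^sub>E \<aa>\<in>max_intersections P. carrier (SR_ring k P \<aa>).
        \<forall>\<aa>\<in>max_intersections P. \<forall>\<bb>\<in>max_intersections P.
          \<bb> \<subseteq> \<aa> \<longrightarrow> SR_proj k P \<aa> \<bb> (q \<aa>) = q \<bb>},
      monoid.mult = (\<lambda>q r. \<lambda>\<aa>\<in>max_intersections P. q \<aa> \<otimes>\<^bsub>SR_ring k P \<aa>\<^esub> r \<aa>),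
      one = (\<lambda>\<aa>\<in>max_intersections P. \<one>\<^bsub>SR_ring k P \<aa>\<^esub>),
      ring.zero = (\<lambda>\<aa>\<in>max_intersections P. \<zero>\<^bsub>SR_ring k P \<aa>\<^esub>),
      add = (\<lambda>q r. \<lambda>\<aa>\<in>max_intersections P. q \<aa> \<oplus>\<^bsub>SR_ring k P \<aa>\<^esub> r \<aa>)\<rparr>"


section \<open>Stanley's face ring\<close>

definition face_base_ideal :: "'k::field itself \<Rightarrow> ('a, 'b) gorder_scheme \<Rightarrow> ('a, 'k) mpoly set" where
  "face_base_ideal k P = Idl\<^bsub>mpoly_ring k (carrier P)\<^esub> {mvar (zero_hat P) - 1}"

definition face_base_ring :: "'k::field itself \<Rightarrow> ('a, 'b) gorder_scheme \<Rightarrow> ('a, 'k) mpoly set ring" where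
  "face_base_ring k P = mpoly_ring k (carrier P) Quot face_base_ideal k P"

definition minimal_upper_bounds :: "('a, 'b) gorder_scheme \<Rightarrow> 'a \<Rightarrow> 'a \<Rightarrow> 'a set" where
  "minimal_upper_bounds P p q = minimal_elements P (Upper P {p, q})"

text \<open>
  When \<open>p\<close> and \<open>q\<close> have no common upper bound, their meet may fail to exist; the sum below is
  then empty and the unspecified value of the meet would be multiplied by zero. The case
  distinction keeps the variable of an unspecified element out of the relation altogether.
\<close>

definition face_relation :: "('a, 'b) gorder_scheme \<Rightarrow> 'a \<Rightarrow> 'a \<Rightarrow> ('a, 'k::field) mpoly" where
  "face_relation P p q =
     (if minimal_upper_bounds P p q = {} then mvar p * mvar q
      else mvar p * mvar q - mvar (p \<sqinter>\<^bsub>P\<^esub> q) * (\<Sum>z\<in>minimal_upper_bounds P p q. mvar z))"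

definition face_ideal :: "'k::field itself \<Rightarrow> ('a, 'b) gorder_scheme \<Rightarrow> ('a, 'k) mpoly set set" where
  "face_ideal k P = Idl\<^bsub>face_base_ring k P\<^esub>
     {face_base_ideal k P +>\<^bsub>mpoly_ring k (carrier P)\<^esub> face_relation P p q | p q.
        p \<in> carrier P \<and> q \<in> carrier P \<and> \<not> p \<sqsubseteq>\<^bsub>P\<^esub> q \<and> \<not> q \<sqsubseteq>\<^bsub>P\<^esub> p}"

definition face_ring :: "'k::field itself \<Rightarrow> ('a, 'b) gorder_scheme \<Rightarrow> ('a, 'k) mpoly set set ring" where
  "face_ring k P = face_base_ring k P Quot face_ideal k P"

section \<open>The objects above are commutative rings\<close>

lemma mpoly_ring_simps:
  "carrier (mpoly_ring k V) = {f. \<forall>m\<in>Poly_Mapping.keys f. Poly_Mapping.keys m \<subseteq> V}"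
  "f \<otimes>\<^bsub>mpoly_ring k V\<^esub> g = f * g"
  "f \<oplus>\<^bsub>mpoly_ring k V\<^esub> g = f + g"
  "\<one>\<^bsub>mpoly_ring k V\<^esub> = 1"
  "\<zero>\<^bsub>mpoly_ring k V\<^esub> = 0"
  by (simp_all add: mpoly_ring_def ring_of_type_algebra_def)

lemma keys_exponent_add:
  fixes a b :: "'v \<Rightarrow>\<^sub>0 nat"
  shows "Poly_Mapping.keys (a + b) = Poly_Mapping.keys a \<union> Poly_Mapping.keys b"
  by (auto simp: in_keys_iff lookup_add)

lemma mpoly_mult_closed:
  assumes "f \<in> carrier (mpoly_ring k V)" "g \<in> carrier (mpoly_ring k V)"
  shows "f * g \<in> carrier (mpoly_ring k V)"
  unfolding mpoly_ring_simps
proof (intro CollectI ballI)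
  fix m assume "m \<in> Poly_Mapping.keys (f * g)"
  then obtain a b where "a \<in> Poly_Mapping.keys f" "b \<in> Poly_Mapping.keys g" "m = a + b"
    using keys_mult[of f g] by blast
  thus "Poly_Mapping.keys m \<subseteq> V" using assms by (simp add: mpoly_ring_simps keys_exponent_add)
qed

lemma mpoly_add_closed:
  assumes "f \<in> carrier (mpoly_ring k V)" "g \<in> carrier (mpoly_ring k V)"
  shows "f + g \<in> carrier (mpoly_ring k V)"
  using assms keys_add[of f g] by (auto simp: mpoly_ring_simps)

lemma mpoly_one_closed: "1 \<in> carrier (mpoly_ring k V)"
  by (auto simp: mpoly_ring_simps)

lemma mpoly_zero_closed: "0 \<in> carrier (mpoly_ring k V)"
  by (auto simp: mpoly_ring_simps)

lemma mpoly_const_closed: "mconst c \<in> carrier (mpoly_ring k V)"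
  by (auto simp: mpoly_ring_simps mconst_def split: if_splits)

lemma mpoly_var_closed: "v \<in> V \<Longrightarrow> mvar v \<in> carrier (mpoly_ring k V)"
  by (auto simp: mpoly_ring_simps mvar_def)

lemma mpoly_uminus_closed: "f \<in> carrier (mpoly_ring k V) \<Longrightarrow> - f \<in> carrier (mpoly_ring k V)"
  by (auto simp: mpoly_ring_simps)

lemma mpoly_power_closed:
  "f \<in> carrier (mpoly_ring k V) \<Longrightarrow> f ^ n \<in> carrier (mpoly_ring k V)"
  by (induction n) (auto simp: mpoly_one_closed mpoly_mult_closed)

lemma mpoly_prod_closed:
  "(\<And>i. i \<in> I \<Longrightarrow> f i \<in> carrier (mpoly_ring k V)) \<Longrightarrow> prod f I \<in> carrier (mpoly_ring k V)"
  by (induction I rule: infinite_finite_induct) (auto simp: mpoly_one_closed mpoly_mult_closed)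

lemma mpoly_sum_closed:
  "(\<And>i. i \<in> I \<Longrightarrow> f i \<in> carrier (mpoly_ring k V)) \<Longrightarrow> sum f I \<in> carrier (mpoly_ring k V)"
  by (induction I rule: infinite_finite_induct) (auto simp: mpoly_zero_closed mpoly_add_closed)

lemma cring_mpoly_ring: "cring (mpoly_ring k V)"
proof (rule cringI)
  show "abelian_group (mpoly_ring k V)"
  proof (rule abelian_groupI)
    fix f assume "f \<in> carrier (mpoly_ring k V)"
    thus "\<exists>g\<in>carrier (mpoly_ring k V). g \<oplus>\<^bsub>mpoly_ring k V\<^esub> f = \<zero>\<^bsub>mpoly_ring k V\<^esub>"
      using mpoly_uminus_closed by (intro bexI[of _ "- f"]) (auto simp: mpoly_ring_simps(2-))
  qed (auto simp: mpoly_ring_simps(2-) mpoly_add_closed mpoly_zero_closed algebra_simps)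
  show "comm_monoid (mpoly_ring k V)"
    by (rule comm_monoidI)
      (auto simp: mpoly_ring_simps(2-) mpoly_mult_closed mpoly_one_closed algebra_simps)
qed (auto simp: mpoly_ring_simps(2-) algebra_simps)

lemma ring_mpoly_ring: "ring (mpoly_ring k V)"
  using cring_mpoly_ring cring.axioms(1) by blast

lemma SR_gens_subset:
  "{\<Prod>v\<in>\<sigma>. mvar v | \<sigma>. \<sigma> \<subseteq> atoms P \<inter> \<aa> \<and> \<sigma> \<notin> atoms_below P ` \<aa>}
     \<subseteq> carrier (mpoly_ring k (atoms P \<inter> \<aa>))"
  by (auto intro!: mpoly_prod_closed mpoly_var_closed)

lemma ideal_SR_ideal: "ideal (SR_ideal k P \<aa>) (mpoly_ring k (atoms P \<inter> \<aa>))"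
  unfolding SR_ideal_def by (rule ring.genideal_ideal[OF ring_mpoly_ring SR_gens_subset])

lemma cring_SR_ring: "cring (SR_ring k P \<aa>)"
  unfolding SR_ring_def by (rule ideal.quotient_is_cring[OF ideal_SR_ideal cring_mpoly_ring])

lemma zero_hat_minimal:
  assumes "simplicial_poset P"
  shows "zero_hat P \<in> minimal_elements P (carrier P)"
  using assms unfolding simplicial_poset_def zero_hat_def by (metis (no_types, lifting) theI')

lemma cring_face_ring:
  assumes P: "simplicial_poset P"
  shows "cring (face_ring k P)"
proof -
  let ?R = "mpoly_ring k (carrier P)"
  have z: "zero_hat P \<in> carrier P"
    using zero_hat_minimal[OF P] by (simp add: minimal_elements_def)
  have "mvar (zero_hat P) + - 1 \<in> carrier ?R"
    by (intro mpoly_add_closed mpoly_uminus_closed mpoly_one_closed mpoly_var_closed z)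
  hence I: "ideal (face_base_ideal k P) ?R"
    unfolding face_base_ideal_def by (intro ring.genideal_ideal ring_mpoly_ring) simp
  have S: "cring (face_base_ring k P)"
    unfolding face_base_ring_def by (rule ideal.quotient_is_cring[OF I cring_mpoly_ring])
  have rel: "face_relation P p q \<in> carrier ?R" if pq: "p \<in> carrier P" "q \<in> carrier P" for p q
  proof (cases "minimal_upper_bounds P p q = {}")
    case True
    thus ?thesis using pq by (simp add: face_relation_def mpoly_mult_closed mpoly_var_closed)
  next
    case False
    then obtain z where z: "z \<in> Upper P {p, q}"
      by (auto simp: minimal_upper_bounds_def minimal_elements_def)
    hence zP: "z \<in> carrier P" and pz: "p \<in> lower_interval P z" "q \<in> lower_interval P z"
      using pq by (auto simp: Upper_def lower_interval_def)
    interpret partial_order P using P by (simp add: simplicial_poset_def)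
    interpret L: bounded_lattice "P\<lparr>carrier := lower_interval P z\<rparr>"
      using P zP by (simp add: simplicial_poset_def boolean_algebra_on_def)
    obtain i where i: "greatest (P\<lparr>carrier := lower_interval P z\<rparr>) i
        (Lower (P\<lparr>carrier := lower_interval P z\<rparr>) {p, q})"
      using L.inf_of_two_exists[of p q] pz by (simp, blast)
    have "greatest P i (Lower P {p, q})"
      unfolding greatest_def
    proof (intro conjI ballI)
      show "i \<in> Lower P {p, q}" "Lower P {p, q} \<subseteq> carrier P"
        using i pz by (auto simp: greatest_def Lower_def lower_interval_def)
      fix y assume y: "y \<in> Lower P {p, q}"
      hence yP: "y \<in> carrier P" "y \<sqsubseteq>\<^bsub>P\<^esub> p" "y \<sqsubseteq>\<^bsub>P\<^esub> q"
        using pq by (auto simp: Lower_def)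
      have "p \<sqsubseteq>\<^bsub>P\<^esub> z" using pz by (simp add: lower_interval_def)
      hence "y \<sqsubseteq>\<^bsub>P\<^esub> z" by (rule le_trans[OF yP(2) _ yP(1) pq(1) zP])
      hence "y \<in> Lower (P\<lparr>carrier := lower_interval P z\<rparr>) {p, q}"
        using yP by (auto simp: Lower_def lower_interval_def)
      thus "y \<sqsubseteq>\<^bsub>P\<^esub> i" using i by (simp add: greatest_def)
    qed
    hence "greatest P (p \<sqinter>\<^bsub>P\<^esub> q) (Lower P {p, q})"
      unfolding meet_def inf_def by (rule someI)
    hence "p \<sqinter>\<^bsub>P\<^esub> q \<in> carrier P" by (simp add: greatest_def Lower_def)
    moreover have "minimal_upper_bounds P p q \<subseteq> carrier P"
      by (auto simp: minimal_upper_bounds_def minimal_elements_def Upper_def)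
    ultimately have "mvar p * mvar q + - (mvar (p \<sqinter>\<^bsub>P\<^esub> q) * (\<Sum>z\<in>minimal_upper_bounds P p q. mvar z))
        \<in> carrier ?R"
      using pq by (intro mpoly_add_closed mpoly_uminus_closed mpoly_mult_closed mpoly_sum_closed
          mpoly_var_closed) (simp_all add: subset_iff)
    thus ?thesis using False by (simp add: face_relation_def)
  qed
  have "ideal (face_ideal k P) (face_base_ring k P)"
    unfolding face_ideal_def
  proof (rule ring.genideal_ideal)
    show "ring (face_base_ring k P)" using S by (rule cring.axioms)
    show "{face_base_ideal k P +>\<^bsub>?R\<^esub> face_relation P p q | p q.
        p \<in> carrier P \<and> q \<in> carrier P \<and> \<not> p \<sqsubseteq>\<^bsub>P\<^esub> q \<and> \<not> q \<sqsubseteq>\<^bsub>P\<^esub> p} \<subseteq> carrier (face_base_ring k P)"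
    proof (rule subsetI, elim CollectE exE conjE)
      fix C p q assume "p \<in> carrier P" "q \<in> carrier P"
        "C = face_base_ideal k P +>\<^bsub>?R\<^esub> face_relation P p q"
      thus "C \<in> carrier (face_base_ring k P)"
        unfolding face_base_ring_def FactRing_def A_RCOSETS_def' using rel by simp blast
    qed
  qed
  thus ?thesis unfolding face_ring_def by (rule ideal.quotient_is_cring[OF _ S])
qed

lemma mconst_simps:
  "mconst (a + b) = mconst a + mconst b" "mconst (a * b) = mconst a * mconst b"
  "mconst 0 = 0" "mconst 1 = 1"
  by (simp_all add: mconst_def single_add mult_single)

lemma msubst_superset:
  assumes "finite A" "Poly_Mapping.keys f \<subseteq> A"
  shows "msubst g f = (\<Sum>m\<in>A. mconst (Poly_Mapping.lookup f m) *
     (\<Prod>v\<in>Poly_Mapping.keys m. g v ^ Poly_Mapping.lookup m v))"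
  unfolding msubst_def using assms
  by (intro sum.mono_neutral_left) (auto simp: in_keys_iff mconst_simps)

lemma msubst_add: "msubst g (f + h) = msubst g f + msubst g h"
proof -
  let ?A = "Poly_Mapping.keys f \<union> Poly_Mapping.keys h"
  have "Poly_Mapping.keys (f + h) \<subseteq> ?A" by (rule keys_add)
  thus ?thesis
    by (simp add: msubst_superset[of ?A] lookup_add mconst_simps algebra_simps sum.distrib)
qed

lemma msubst_zero: "msubst g 0 = 0"
  by (simp add: msubst_def)

lemma msubst_sum: "msubst g (sum f I) = (\<Sum>i\<in>I. msubst g (f i))"
  by (induction I rule: infinite_finite_induct) (auto simp: msubst_add msubst_zero)

lemma msubst_single:
  "msubst g (Poly_Mapping.single m c) = mconst c * (\<Prod>v\<in>Poly_Mapping.keys m. g v ^ Poly_Mapping.lookup m v)"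
  by (subst msubst_superset[of "{m}"]) auto

lemma monom_prod_superset:
  assumes "finite A" "Poly_Mapping.keys m \<subseteq> A"
  shows "(\<Prod>v\<in>Poly_Mapping.keys m. g v ^ Poly_Mapping.lookup m v) =
    (\<Prod>v\<in>A. g v ^ Poly_Mapping.lookup m v :: 'c::comm_monoid_mult)"
  using assms by (intro prod.mono_neutral_left) (auto simp: in_keys_iff)

lemma msubst_single_mult:
  "msubst g (Poly_Mapping.single m c * Poly_Mapping.single n d) =
     msubst g (Poly_Mapping.single m c) * msubst g (Poly_Mapping.single n d)"
proof -
  let ?A = "Poly_Mapping.keys m \<union> Poly_Mapping.keys n"
  show ?thesis
    by (simp add: mult_single msubst_single mconst_simps monom_prod_superset[of ?A]
        keys_exponent_add lookup_add power_add prod.distrib ac_simps)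
qed

lemma mpoly_monomials: "f = (\<Sum>m\<in>Poly_Mapping.keys f. Poly_Mapping.single m (Poly_Mapping.lookup f m))"
  by (rule poly_mapping_eqI) (auto simp: lookup_sum lookup_single when_def in_keys_iff)

lemma msubst_mult: "msubst g (f * h) = msubst g f * msubst g h"
proof -
  have "msubst g (f * h) = msubst g
     ((\<Sum>m\<in>Poly_Mapping.keys f. Poly_Mapping.single m (Poly_Mapping.lookup f m)) *
      (\<Sum>m\<in>Poly_Mapping.keys h. Poly_Mapping.single m (Poly_Mapping.lookup h m)))"
    by (simp flip: mpoly_monomials)
  also have "\<dots> = msubst g (\<Sum>m\<in>Poly_Mapping.keys f. Poly_Mapping.single m (Poly_Mapping.lookup f m)) *
      msubst g (\<Sum>m\<in>Poly_Mapping.keys h. Poly_Mapping.single m (Poly_Mapping.lookup h m))"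
    by (simp add: sum_product msubst_sum msubst_single_mult)
  finally show ?thesis by (simp flip: mpoly_monomials)
qed

lemma msubst_one: "msubst g 1 = 1"
  using msubst_single[of g 0 1] by (simp add: mconst_simps)

lemma msubst_var: "msubst g (mvar v) = g v"
  by (simp add: mvar_def msubst_single mconst_simps)

lemma msubst_prod: "msubst g (prod f I) = (\<Prod>i\<in>I. msubst g (f i))"
  by (induction I rule: infinite_finite_induct) (auto simp: msubst_mult msubst_one)

lemma msubst_closed:
  assumes "\<And>v. g v \<in> carrier (mpoly_ring k W)"
  shows "msubst g f \<in> carrier (mpoly_ring k W)"
  unfolding msubst_def
  by (intro mpoly_sum_closed mpoly_mult_closed mpoly_const_closed mpoly_prod_closed
      mpoly_power_closed assms)

context
  fixes P :: "('a, 'b) gorder_scheme" and k :: "'k::field itself" and \<aa> \<bb> :: "'a set"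
  assumes sub: "\<bb> \<subseteq> \<aa>" and fin: "finite \<aa>"
begin

abbreviation (input) "proj_rep \<equiv> \<lambda>f. SR_ideal k P \<bb> +>\<^bsub>mpoly_ring k (atoms P \<inter> \<bb>)\<^esub>
        msubst (\<lambda>v. if v \<in> \<bb> then mvar v else 0) f"

lemma proj_subst_closed:
  "msubst (\<lambda>v. if v \<in> atoms P \<inter> \<bb> then mvar v else 0) f \<in> carrier (mpoly_ring k (atoms P \<inter> \<bb>))"
  by (intro msubst_closed) (auto intro: mpoly_var_closed mpoly_zero_closed)

lemma proj_subst_eq:
  assumes "f \<in> carrier (mpoly_ring k (atoms P \<inter> \<aa>))"
  shows "msubst (\<lambda>v. if v \<in> \<bb> then mvar v else 0) f =
    msubst (\<lambda>v. if v \<in> atoms P \<inter> \<bb> then mvar v else 0) f"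
  unfolding msubst_def using assms
  by (intro sum.cong prod.cong arg_cong2[of _ _ _ _ "(*)"]) (auto simp: mpoly_ring_simps)

lemma proj_rep_hom:
  "ring_hom_ring (mpoly_ring k (atoms P \<inter> \<aa>)) (SR_ring k P \<bb>) proj_rep"
proof (rule ring_hom_ringI2)
  interpret I: ideal "SR_ideal k P \<bb>" "mpoly_ring k (atoms P \<inter> \<bb>)" by (rule ideal_SR_ideal)
  note h = I.rcos_ring_hom
  show "proj_rep \<in> ring_hom (mpoly_ring k (atoms P \<inter> \<aa>)) (SR_ring k P \<bb>)"
  proof (rule ring_hom_memI)
    fix f assume f: "f \<in> carrier (mpoly_ring k (atoms P \<inter> \<aa>))"
    have f': "msubst (\<lambda>v. if v \<in> \<bb> then mvar v else 0) f \<in> carrier (mpoly_ring k (atoms P \<inter> \<bb>))"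
      using proj_subst_closed[of f] proj_subst_eq[OF f] by simp
    show "proj_rep f \<in> carrier (SR_ring k P \<bb>)"
      using ring_hom_closed[OF h f'] by (simp add: SR_ring_def)
    fix g assume g: "g \<in> carrier (mpoly_ring k (atoms P \<inter> \<aa>))"
    have g': "msubst (\<lambda>v. if v \<in> \<bb> then mvar v else 0) g \<in> carrier (mpoly_ring k (atoms P \<inter> \<bb>))"
      using proj_subst_closed[of g] proj_subst_eq[OF g] by simp
    show "proj_rep (f \<otimes>\<^bsub>mpoly_ring k (atoms P \<inter> \<aa>)\<^esub> g) = proj_rep f \<otimes>\<^bsub>SR_ring k P \<bb>\<^esub> proj_rep g"
      using ring_hom_mult[OF h f' g'] by (simp add: SR_ring_def mpoly_ring_simps(2-) msubst_mult)
    show "proj_rep (f \<oplus>\<^bsub>mpoly_ring k (atoms P \<inter> \<aa>)\<^esub> g) = proj_rep f \<oplus>\<^bsub>SR_ring k P \<bb>\<^esub> proj_rep g"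
      using ring_hom_add[OF h f' g'] by (simp add: SR_ring_def mpoly_ring_simps(2-) msubst_add)
  next
    show "proj_rep \<one>\<^bsub>mpoly_ring k (atoms P \<inter> \<aa>)\<^esub> = \<one>\<^bsub>SR_ring k P \<bb>\<^esub>"
      using ring_hom_one[OF h] by (simp add: SR_ring_def mpoly_ring_simps(2-) msubst_one)
  qed
qed (use cring_SR_ring cring.axioms(1) ring_mpoly_ring in blast)+

lemma proj_rep_kernel:
  "SR_ideal k P \<aa> \<subseteq> a_kernel (mpoly_ring k (atoms P \<inter> \<aa>)) (SR_ring k P \<bb>) proj_rep"
proof -
  interpret h: ring_hom_ring "mpoly_ring k (atoms P \<inter> \<aa>)" "SR_ring k P \<bb>" proj_rep
    by (rule proj_rep_hom)
  interpret I: ideal "SR_ideal k P \<bb>" "mpoly_ring k (atoms P \<inter> \<bb>)" by (rule ideal_SR_ideal)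
  have zero: "proj_rep f = \<zero>\<^bsub>SR_ring k P \<bb>\<^esub>"
    if "msubst (\<lambda>v. if v \<in> \<bb> then mvar v else 0) f \<in> SR_ideal k P \<bb>" for f
    using that I.a_rcos_const by (simp add: SR_ring_def FactRing_def)
  have gens: "proj_rep (\<Prod>v\<in>\<sigma>. mvar v) = \<zero>\<^bsub>SR_ring k P \<bb>\<^esub>"
    if \<sigma>: "\<sigma> \<subseteq> atoms P \<inter> \<aa>" "\<sigma> \<notin> atoms_below P ` \<aa>" for \<sigma>
  proof (rule zero, cases "\<sigma> \<subseteq> \<bb>")
    case True
    have "(\<Prod>v\<in>\<sigma>. mvar v) \<in> SR_ideal k P \<bb>"
      unfolding SR_ideal_def
      by (rule subsetD[OF ring.genideal_self[OF ring_mpoly_ring SR_gens_subset]])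
        (use True \<sigma> sub in blast)
    moreover have "msubst (\<lambda>v. if v \<in> \<bb> then mvar v else 0) (\<Prod>v\<in>\<sigma>. mvar v) = (\<Prod>v\<in>\<sigma>. mvar v :: ('a, 'k) mpoly)"
      unfolding msubst_prod msubst_var using True by (intro prod.cong) auto
    ultimately show "msubst (\<lambda>v. if v \<in> \<bb> then mvar v else 0) (\<Prod>v\<in>\<sigma>. mvar v) \<in> SR_ideal k P \<bb>"
      by simp
  next
    case False
    then obtain v where "v \<in> \<sigma>" "v \<notin> \<bb>" by auto
    moreover have "finite \<sigma>" using \<sigma>(1) fin finite_subset by blast
    ultimately have "(\<Prod>v\<in>\<sigma>. if v \<in> \<bb> then mvar v else 0 :: ('a, 'k) mpoly) = 0"
      by (intro prod_zero) auto
    thus "msubst (\<lambda>v. if v \<in> \<bb> then mvar v else 0) (\<Prod>v\<in>\<sigma>. mvar v) \<in> SR_ideal k P \<bb>"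
      using additive_subgroup.zero_closed[OF ideal.axioms(1)[OF ideal_SR_ideal[of k P \<bb>]]]
      by (simp add: msubst_prod msubst_var mpoly_ring_simps(5))
  qed
  have "{\<Prod>v\<in>\<sigma>. mvar v | \<sigma>. \<sigma> \<subseteq> atoms P \<inter> \<aa> \<and> \<sigma> \<notin> atoms_below P ` \<aa>}
      \<subseteq> a_kernel (mpoly_ring k (atoms P \<inter> \<aa>)) (SR_ring k P \<bb>) proj_rep"
  proof (rule subsetI)
    fix f :: "('a, 'k) mpoly"
    assume f: "f \<in> {\<Prod>v\<in>\<sigma>. mvar v | \<sigma>. \<sigma> \<subseteq> atoms P \<inter> \<aa> \<and> \<sigma> \<notin> atoms_below P ` \<aa>}"
    then obtain \<sigma> where \<sigma>: "f = (\<Prod>v\<in>\<sigma>. mvar v)" "\<sigma> \<subseteq> atoms P \<inter> \<aa>" "\<sigma> \<notin> atoms_below P ` \<aa>"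
      by blast
    have "proj_rep f = \<zero>\<^bsub>SR_ring k P \<bb>\<^esub>" unfolding \<sigma>(1) by (rule gens[OF \<sigma>(2,3)])
    moreover have "f \<in> carrier (mpoly_ring k (atoms P \<inter> \<aa>))"
      by (rule subsetD[OF SR_gens_subset f])
    ultimately show "f \<in> a_kernel (mpoly_ring k (atoms P \<inter> \<aa>)) (SR_ring k P \<bb>) proj_rep"
      unfolding a_kernel_def' by blast
  qed
  thus ?thesis unfolding SR_ideal_def[of k P \<aa>]
    by (rule ring.genideal_minimal[OF ring_mpoly_ring h.kernel_is_ideal])
qed

lemma SR_proj_coset:
  assumes f: "f \<in> carrier (mpoly_ring k (atoms P \<inter> \<aa>))"
  shows "SR_proj k P \<aa> \<bb> (SR_ideal k P \<aa> +>\<^bsub>mpoly_ring k (atoms P \<inter> \<aa>)\<^esub> f) =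
    SR_ideal k P \<bb> +>\<^bsub>mpoly_ring k (atoms P \<inter> \<bb>)\<^esub> msubst (\<lambda>v. if v \<in> \<bb> then mvar v else 0) f"
proof -
  interpret h: ring_hom_ring "mpoly_ring k (atoms P \<inter> \<aa>)" "SR_ring k P \<bb>" proj_rep
    by (rule proj_rep_hom)
  interpret I: ideal "SR_ideal k P \<aa>" "mpoly_ring k (atoms P \<inter> \<aa>)" by (rule ideal_SR_ideal)
  have "proj_rep g = proj_rep f"
    if g: "g \<in> SR_ideal k P \<aa> +>\<^bsub>mpoly_ring k (atoms P \<inter> \<aa>)\<^esub> f" for g
  proof -
    obtain i where i: "i \<in> SR_ideal k P \<aa>" "g = i \<oplus>\<^bsub>mpoly_ring k (atoms P \<inter> \<aa>)\<^esub> f"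
      using g[unfolded a_r_coset_def' UN_iff singleton_iff] by (elim bexE)
    have i': "i \<in> carrier (mpoly_ring k (atoms P \<inter> \<aa>))" "proj_rep i = \<zero>\<^bsub>SR_ring k P \<bb>\<^esub>"
      using subsetD[OF proj_rep_kernel i(1)] unfolding a_kernel_def' mem_Collect_eq by (rule conjunct1, rule conjunct2)
    show ?thesis
      unfolding i(2) h.hom_add[OF i'(1) f] i'(2) by (rule h.S.l_zero[OF h.hom_closed[OF f]])
  qed
  moreover have "f \<in> SR_ideal k P \<aa> +>\<^bsub>mpoly_ring k (atoms P \<inter> \<aa>)\<^esub> f"
    using f by (rule I.a_rcos_self)
  ultimately show ?thesis unfolding SR_proj_def 
    by (intro the_elem_image_unique) (rule notI, simp only: empty_iff)
qed

lemma SR_proj_hom: "ring_hom_ring (SR_ring k P \<aa>) (SR_ring k P \<bb>) (SR_proj k P \<aa> \<bb>)"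
proof (rule ring_hom_ringI2)
  interpret h: ring_hom_ring "mpoly_ring k (atoms P \<inter> \<aa>)" "SR_ring k P \<bb>" proj_rep
    by (rule proj_rep_hom)
  interpret I: ideal "SR_ideal k P \<aa>" "mpoly_ring k (atoms P \<inter> \<aa>)" by (rule ideal_SR_ideal)
  interpret q: ring_hom_ring "mpoly_ring k (atoms P \<inter> \<aa>)" "SR_ring k P \<aa>"
      "(+>\<^bsub>mpoly_ring k (atoms P \<inter> \<aa>)\<^esub>) (SR_ideal k P \<aa>)"
    unfolding SR_ring_def by (rule I.rcos_ring_hom_ring)
  have rep: "\<exists>f\<in>carrier (mpoly_ring k (atoms P \<inter> \<aa>)).
      C = SR_ideal k P \<aa> +>\<^bsub>mpoly_ring k (atoms P \<inter> \<aa>)\<^esub> f" if "C \<in> carrier (SR_ring k P \<aa>)" for C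
    using that unfolding SR_ring_def FactRing_def A_RCOSETS_def' partial_object.simps
      UN_iff singleton_iff .
  show "SR_proj k P \<aa> \<bb> \<in> ring_hom (SR_ring k P \<aa>) (SR_ring k P \<bb>)"
  proof (rule ring_hom_memI)
    fix C assume C: "C \<in> carrier (SR_ring k P \<aa>)"
    obtain f where f: "f \<in> carrier (mpoly_ring k (atoms P \<inter> \<aa>))"
      "C = SR_ideal k P \<aa> +>\<^bsub>mpoly_ring k (atoms P \<inter> \<aa>)\<^esub> f" using rep[OF C] by (elim bexE)
    show "SR_proj k P \<aa> \<bb> C \<in> carrier (SR_ring k P \<bb>)"
      unfolding f(2) SR_proj_coset[OF f(1)] by (rule h.hom_closed[OF f(1)])
    fix D assume D: "D \<in> carrier (SR_ring k P \<aa>)"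
    obtain g where g: "g \<in> carrier (mpoly_ring k (atoms P \<inter> \<aa>))"
      "D = SR_ideal k P \<aa> +>\<^bsub>mpoly_ring k (atoms P \<inter> \<aa>)\<^esub> g" using rep[OF D] by (elim bexE)
    show "SR_proj k P \<aa> \<bb> (C \<otimes>\<^bsub>SR_ring k P \<aa>\<^esub> D) =
        SR_proj k P \<aa> \<bb> C \<otimes>\<^bsub>SR_ring k P \<bb>\<^esub> SR_proj k P \<aa> \<bb> D"
      unfolding f(2) g(2) q.hom_mult[OF f(1) g(1), symmetric] SR_proj_coset[OF f(1)]
        SR_proj_coset[OF g(1)] SR_proj_coset[OF h.R.m_closed[OF f(1) g(1)]]
      by (rule h.hom_mult[OF f(1) g(1)])
    show "SR_proj k P \<aa> \<bb> (C \<oplus>\<^bsub>SR_ring k P \<aa>\<^esub> D) =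
        SR_proj k P \<aa> \<bb> C \<oplus>\<^bsub>SR_ring k P \<bb>\<^esub> SR_proj k P \<aa> \<bb> D"
      unfolding f(2) g(2) q.hom_add[OF f(1) g(1), symmetric] SR_proj_coset[OF f(1)]
        SR_proj_coset[OF g(1)] SR_proj_coset[OF h.R.a_closed[OF f(1) g(1)]]
      by (rule h.hom_add[OF f(1) g(1)])
  next
    show "SR_proj k P \<aa> \<bb> \<one>\<^bsub>SR_ring k P \<aa>\<^esub> = \<one>\<^bsub>SR_ring k P \<bb>\<^esub>"
      unfolding q.hom_one[symmetric] SR_proj_coset[OF h.R.one_closed] by (rule h.hom_one)
  qed
qed (use cring_SR_ring cring.axioms(1) in blast)+

end

lemma finite_max_intersections:
  assumes "simplicial_poset P" "\<aa> \<in> max_intersections P"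
  shows "finite \<aa>"
proof -
  obtain \<tau> t where "t \<in> \<tau>" "t \<in> carrier P" "\<aa> = ideal_meet P \<tau>"
    using assms(2) by (auto simp: max_intersections_def maximal_elements_def)
  hence "\<aa> \<subseteq> lower_interval P t" "finite (lower_interval P t)"
    using assms(1) by (auto simp: ideal_meet_def simplicial_poset_def)
  thus ?thesis by (rule finite_subset)
qed

lemma cring_sections_ring:
  assumes P: "simplicial_poset P"
  shows "cring (sections_ring k P)"
proof -
  let ?X = "max_intersections P" and ?R = "sections_ring k P"
  have R: "cring (SR_ring k P \<aa>)" for \<aa> by (rule cring_SR_ring)
  note abel = cring.axioms(1)[OF R, THEN ring.is_abelian_group]
  note hom = SR_proj_hom[OF _ finite_max_intersections[OF P]]
  note homs = ring_hom_mult[OF ring_hom_ring.homh[OF hom]] ring_hom_add[OF ring_hom_ring.homh[OF hom]]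
    ring_hom_one[OF ring_hom_ring.homh[OF hom]]
  have homz: "SR_proj k P \<aa> \<bb> \<zero>\<^bsub>SR_ring k P \<aa>\<^esub> = \<zero>\<^bsub>SR_ring k P \<bb>\<^esub>"
    if "\<bb> \<subseteq> \<aa>" "\<aa> \<in> ?X" for \<aa> \<bb>
  proof -
    interpret ring_hom_ring "SR_ring k P \<aa>" "SR_ring k P \<bb>" "SR_proj k P \<aa> \<bb>"
      using hom that by blast
    show ?thesis by simp
  qed
  have homn: "SR_proj k P \<aa> \<bb> (\<ominus>\<^bsub>SR_ring k P \<aa>\<^esub> x) = \<ominus>\<^bsub>SR_ring k P \<bb>\<^esub> SR_proj k P \<aa> \<bb> x"
    if "\<bb> \<subseteq> \<aa>" "\<aa> \<in> ?X" "x \<in> carrier (SR_ring k P \<aa>)" for \<aa> \<bb> x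
  proof -
    interpret ring_hom_ring "SR_ring k P \<aa>" "SR_ring k P \<bb>" "SR_proj k P \<aa> \<bb>"
      using hom that by blast
    show ?thesis using that by simp
  qed
  have car: "q \<in> carrier ?R \<longleftrightarrow> q \<in> extensional ?X \<and> (\<forall>\<aa>\<in>?X. q \<aa> \<in> carrier (SR_ring k P \<aa>)) \<and>
      (\<forall>\<aa>\<in>?X. \<forall>\<bb>\<in>?X. \<bb> \<subseteq> \<aa> \<longrightarrow> SR_proj k P \<aa> \<bb> (q \<aa>) = q \<bb>)" for q
    by (auto simp: sections_ring_def PiE_iff)
  have ops: "x \<otimes>\<^bsub>?R\<^esub> y = (\<lambda>\<aa>\<in>?X. x \<aa> \<otimes>\<^bsub>SR_ring k P \<aa>\<^esub> y \<aa>)"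
      "x \<oplus>\<^bsub>?R\<^esub> y = (\<lambda>\<aa>\<in>?X. x \<aa> \<oplus>\<^bsub>SR_ring k P \<aa>\<^esub> y \<aa>)"
      "\<one>\<^bsub>?R\<^esub> = (\<lambda>\<aa>\<in>?X. \<one>\<^bsub>SR_ring k P \<aa>\<^esub>)" "\<zero>\<^bsub>?R\<^esub> = (\<lambda>\<aa>\<in>?X. \<zero>\<^bsub>SR_ring k P \<aa>\<^esub>)" for x y
    by (simp_all add: sections_ring_def)
  have ext: "(\<lambda>\<aa>\<in>?X. f \<aa>) = g \<longleftrightarrow> (\<forall>\<aa>\<in>?X. f \<aa> = g \<aa>)" if "g \<in> extensional ?X"
    for f g :: "'a set \<Rightarrow> ('a, 'c) mpoly set"
    using that by (auto simp: fun_eq_iff restrict_def extensional_def)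
  have rings: "ring (SR_ring k P \<aa>)" for \<aa> using R by (rule cring.axioms(1))
  have monoids: "Group.monoid (SR_ring k P \<aa>)" for \<aa> using rings by (rule ring.axioms(2))
  have cmonoids: "comm_monoid (SR_ring k P \<aa>)" for \<aa> using R by (rule cring.axioms(2))
  have amonoids: "abelian_monoid (SR_ring k P \<aa>)" for \<aa> using abel by (rule abelian_group.axioms(1))
  note simps = car ops ext homs homz
    monoid.m_closed[OF monoids] monoid.one_closed[OF monoids]
    abelian_monoid.a_closed[OF amonoids] abelian_monoid.zero_closed[OF amonoids]
    monoid.l_one[OF monoids] abelian_monoid.l_zero[OF amonoids]
  show ?thesis
  proof (rule cringI)
    show "abelian_group ?R"
    proof (rule abelian_groupI)
      fix x assume x: "x \<in> carrier ?R"
      have "(\<lambda>\<aa>\<in>?X. \<ominus>\<^bsub>SR_ring k P \<aa>\<^esub> x \<aa>) \<in> carrier ?R"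
        using x by (simp add: car homn abelian_group.a_inv_closed[OF abel])
      moreover have "(\<lambda>\<aa>\<in>?X. \<ominus>\<^bsub>SR_ring k P \<aa>\<^esub> x \<aa>) \<oplus>\<^bsub>?R\<^esub> x = \<zero>\<^bsub>?R\<^esub>"
        using x by (simp add: simps abelian_group.l_neg[OF abel])
      ultimately show "\<exists>y\<in>carrier ?R. y \<oplus>\<^bsub>?R\<^esub> x = \<zero>\<^bsub>?R\<^esub>" by blast
    next
      fix x y z assume "x \<in> carrier ?R" "y \<in> carrier ?R" "z \<in> carrier ?R"
      thus "x \<oplus>\<^bsub>?R\<^esub> y \<oplus>\<^bsub>?R\<^esub> z = x \<oplus>\<^bsub>?R\<^esub> (y \<oplus>\<^bsub>?R\<^esub> z)"
        by (simp add: simps abelian_monoid.a_assoc[OF amonoids])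
    next
      fix x y assume "x \<in> carrier ?R" "y \<in> carrier ?R"
      thus "x \<oplus>\<^bsub>?R\<^esub> y = y \<oplus>\<^bsub>?R\<^esub> x"
        by (simp add: simps abelian_monoid.a_comm[OF amonoids])
    qed (simp_all add: simps)
    show "comm_monoid ?R"
    proof (rule comm_monoidI)
      fix x y z assume "x \<in> carrier ?R" "y \<in> carrier ?R" "z \<in> carrier ?R"
      thus "x \<otimes>\<^bsub>?R\<^esub> y \<otimes>\<^bsub>?R\<^esub> z = x \<otimes>\<^bsub>?R\<^esub> (y \<otimes>\<^bsub>?R\<^esub> z)"
        by (simp add: simps monoid.m_assoc[OF monoids])
    next
      fix x y assume "x \<in> carrier ?R" "y \<in> carrier ?R"
      thus "x \<otimes>\<^bsub>?R\<^esub> y = y \<otimes>\<^bsub>?R\<^esub> x"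
        by (simp add: simps comm_monoid.m_comm[OF cmonoids])
    qed (simp_all add: simps)
  next
    fix x y z assume "x \<in> carrier ?R" "y \<in> carrier ?R" "z \<in> carrier ?R"
    thus "(x \<oplus>\<^bsub>?R\<^esub> y) \<otimes>\<^bsub>?R\<^esub> z = x \<otimes>\<^bsub>?R\<^esub> z \<oplus>\<^bsub>?R\<^esub> y \<otimes>\<^bsub>?R\<^esub> z"
      by (simp add: simps ring.ring_simprules(13)[OF rings])
  qed
qed

end

theory Submission
  imports Defs
begin

text \<open>
  Let \<open>\<Phi>\<close> send a polynomial in the elements of \<open>P\<close> to the section whose component at \<open>\<aa>\<close>
  substitutes for \<open>p\<close> the product of the atoms below \<open>p\<close> if \<open>p \<in> \<aa>\<close>, and \<open>0\<close> otherwise. The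
  nonzero monomials of the ring at \<open>\<aa>\<close> correspond to pairs of an \<open>x \<in> \<aa>\<close> and a monomial with support the
  atoms below \<open>x\<close>, and the projections just forget the pairs with \<open>x \<notin> \<bb>\<close>. Hence a section is a
  family of coefficients indexed by all such pairs with \<open>x \<in> P\<close>, and \<open>\<Phi>\<close> is surjective because
  the pair \<open>(x, m)\<close> is the image of \<open>x\<close> times a monomial in the atoms below \<open>x\<close>. The map \<open>\<Phi>\<close>
  kills the relations of the face ring. Conversely, these relations reduce every polynomial to a
  combination of the monomials just described, and these have distinct pairs as images, so the
  relations generate the whole kernel.
\<close>

section \<open>Simplicial posets\<close>

locale simplicial = partial_order P for P :: "('a, 'b) gorder_scheme" (structure) +
  assumes simplicial: "simplicial_poset P"
begin

abbreviation vs :: "'a \<Rightarrow> 'a set" where "vs \<equiv> atoms_below P"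

lemma zero_closed [simp]: "zero_hat P \<in> carrier P"
  using zero_hat_minimal[OF simplicial] by (simp add: minimal_elements_def)

lemma zero_unique: "z \<in> minimal_elements P (carrier P) \<Longrightarrow> z = zero_hat P"
  using simplicial zero_hat_minimal[OF simplicial] by (auto simp: simplicial_poset_def)

lemma interval_bounded_lattice:
  "t \<in> carrier P \<Longrightarrow> bounded_lattice (P\<lparr>carrier := lower_interval P t\<rparr>)"
  using simplicial by (simp add: simplicial_poset_def boolean_algebra_on_def)

lemma finite_lower_interval: "t \<in> carrier P \<Longrightarrow> finite (lower_interval P t)"
  using simplicial by (simp add: simplicial_poset_def)

lemma le_lless: "x \<sqsubset> y \<longleftrightarrow> x \<sqsubseteq> y \<and> x \<noteq> y"
  by (simp add: lless_def eq_is_equal)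

text \<open>Whatever lies below the bottom of an interval lies in the interval again. So this bottom
  is minimal in the whole poset, and uniqueness of the minimal element applies.\<close>

lemma interval_bottom:
  assumes t: "t \<in> carrier P"
  shows "\<bottom>\<^bsub>P\<lparr>carrier := lower_interval P t\<rparr>\<^esub> = zero_hat P"
proof -
  interpret L: bounded_lattice "P\<lparr>carrier := lower_interval P t\<rparr>"
    by (rule interval_bounded_lattice[OF t])
  let ?b = "\<bottom>\<^bsub>P\<lparr>carrier := lower_interval P t\<rparr>\<^esub>"
  have b: "?b \<in> lower_interval P t" using L.bottom_closed by simp
  have "?b \<in> minimal_elements P (carrier P)"
    unfolding minimal_elements_def
  proof (intro CollectI conjI ballI impI)
    show "?b \<in> carrier P" using b by (simp add: lower_interval_def)
    fix y assume y: "y \<in> carrier P" "y \<sqsubseteq> ?b"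
    have "y \<in> lower_interval P t"
      using y b t le_trans[of y ?b t] by (auto simp: lower_interval_def)
    then have "?b \<sqsubseteq> y" using L.bottom_lower[of y] by simp
    then show "y = ?b" using y b le_antisym by (simp add: lower_interval_def)
  qed
  then show ?thesis by (rule zero_unique)
qed

lemma zero_le [simp]:
  assumes t: "t \<in> carrier P" shows "zero_hat P \<sqsubseteq> t"
proof -
  interpret L: bounded_lattice "P\<lparr>carrier := lower_interval P t\<rparr>"
    by (rule interval_bounded_lattice[OF t])
  show ?thesis using L.bottom_closed interval_bottom[OF t] by (simp add: lower_interval_def)
qed

section \<open>Atoms and the sets of atoms below an element\<close>

lemma atom_closed: "v \<in> atoms P \<Longrightarrow> v \<in> carrier P"
  by (simp add: atoms_def)

lemma atom_not_zero: "v \<in> atoms P \<Longrightarrow> v \<noteq> zero_hat P"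
  by (auto simp: atoms_def le_lless)

lemma le_atom:
  "v \<in> atoms P \<Longrightarrow> x \<in> carrier P \<Longrightarrow> x \<sqsubseteq> v \<Longrightarrow> x = v \<or> x = zero_hat P"
  by (force simp: atoms_def le_lless)

lemma vs_zero [simp]: "vs (zero_hat P) = {}"
  using le_antisym[of _ "zero_hat P"] atom_closed atom_not_zero by (force simp: atoms_below_def)

lemma vs_atom: "v \<in> atoms P \<Longrightarrow> vs v = {v}"
  using le_atom[of v] atom_closed atom_not_zero by (force simp: atoms_below_def)

lemma vs_mono:
  "x \<sqsubseteq> y \<Longrightarrow> x \<in> carrier P \<Longrightarrow> y \<in> carrier P \<Longrightarrow> vs x \<subseteq> vs y"
  using le_trans atom_closed by (auto simp: atoms_below_def)

lemma vs_subset_interval: "vs x \<subseteq> lower_interval P x"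
  by (auto simp: atoms_below_def lower_interval_def atoms_def)

lemma finite_vs: "x \<in> carrier P \<Longrightarrow> finite (vs x)"
  using finite_lower_interval vs_subset_interval finite_subset by blast

text \<open>The size of the lower interval serves as a rank: minimising it produces atoms,
  maximising it produces maximal elements.\<close>

lemma lower_interval_mono_strict:
  assumes "x \<in> carrier P" "y \<in> carrier P" "x \<sqsubseteq> y" "x \<noteq> y"
  shows "card (lower_interval P x) < card (lower_interval P y)"
proof (rule psubset_card_mono)
  show "finite (lower_interval P y)" using assms by (simp add: finite_lower_interval)
  show "lower_interval P x \<subset> lower_interval P y"
  proof (rule psubsetI)
    show "lower_interval P x \<subseteq> lower_interval P y"
      using assms le_trans[of _ x y] by (auto simp: lower_interval_def)
    have "y \<in> lower_interval P y" "y \<notin> lower_interval P x"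
      using assms le_antisym by (auto simp: lower_interval_def)
    then show "lower_interval P x \<noteq> lower_interval P y" by blast
  qed
qed

text \<open>Among the nonzero elements below \<open>w\<close>, one with the smallest lower interval
  has nothing strictly between it and zero.\<close>

lemma atom_exists:
  assumes "w \<in> carrier P" "w \<noteq> zero_hat P"
  shows "\<exists>v. v \<in> vs w"
proof -
  obtain v where v: "v \<in> carrier P" "v \<sqsubseteq> w" "v \<noteq> zero_hat P"
    and least: "\<And>y. y \<in> carrier P \<Longrightarrow> y \<sqsubseteq> w \<Longrightarrow> y \<noteq> zero_hat P \<Longrightarrow>
       card (lower_interval P v) \<le> card (lower_interval P y)"
    using ex_has_least_nat[of "\<lambda>v. v \<in> carrier P \<and> v \<sqsubseteq> w \<and> v \<noteq> zero_hat P" w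
        "\<lambda>v. card (lower_interval P v)"] assms by auto
  have "\<not> (zero_hat P \<sqsubset> x \<and> x \<sqsubset> v)" if x: "x \<in> carrier P" for x
  proof
    assume "zero_hat P \<sqsubset> x \<and> x \<sqsubset> v"
    then have le: "x \<sqsubseteq> v" "x \<noteq> v" "x \<noteq> zero_hat P" by (auto simp: le_lless)
    then show False
      using lower_interval_mono_strict[OF x v(1) le(1,2)] least[OF x _ le(3)]
        le_trans[OF le(1) v(2) x v(1) assms(1)] by simp
  qed
  then have "v \<in> atoms P"
    using v by (auto simp: atoms_def le_lless)
  then show ?thesis using v by (auto simp: atoms_below_def)
qed

text \<open>Let \<open>y'\<close> be a complement of \<open>y\<close> in the interval below
  \<open>t\<close>. An atom below both \<open>x\<close> and \<open>y'\<close> would lie below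
  \<open>y\<close> as well, hence below the bottom. So \<open>x\<close> meets \<open>y'\<close> in
  zero, and distributivity puts \<open>x\<close> below its meet with \<open>y\<close>.\<close>

lemma vs_subset_imp_le:
  assumes t: "t \<in> carrier P" and x: "x \<in> carrier P" "x \<sqsubseteq> t" and y: "y \<in> carrier P" "y \<sqsubseteq> t"
    and sub: "vs x \<subseteq> vs y"
  shows "x \<sqsubseteq> y"
proof -
  let ?L = "P\<lparr>carrier := lower_interval P t\<rparr>"
  interpret L: bounded_lattice ?L by (rule interval_bounded_lattice[OF t])
  have xy: "x \<in> carrier ?L" "y \<in> carrier ?L" using x y by (auto simp: lower_interval_def)
  have bool: "boolean_algebra_on ?L" using simplicial t by (simp add: simplicial_poset_def)
  then obtain y' where y': "y' \<in> carrier ?L" "y \<squnion>\<^bsub>?L\<^esub> y' = \<top>\<^bsub>?L\<^esub>" "y \<sqinter>\<^bsub>?L\<^esub> y' = \<bottom>\<^bsub>?L\<^esub>"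
    using xy unfolding boolean_algebra_on_def by blast
  have distrib: "x \<sqinter>\<^bsub>?L\<^esub> (y \<squnion>\<^bsub>?L\<^esub> y') = (x \<sqinter>\<^bsub>?L\<^esub> y) \<squnion>\<^bsub>?L\<^esub> (x \<sqinter>\<^bsub>?L\<^esub> y')"
    using bool xy y'(1) unfolding boolean_algebra_on_def by blast
  let ?w = "x \<sqinter>\<^bsub>?L\<^esub> y'"
  have w: "?w \<in> carrier ?L" by (rule L.meet_closed[OF xy(1) y'(1)])
  then have wP: "?w \<in> carrier P" by (simp add: lower_interval_def)
  have "?w = zero_hat P"
  proof (rule ccontr)
    assume "?w \<noteq> zero_hat P"
    then obtain v where v: "v \<in> vs ?w" using atom_exists[OF wP] by blast
    then have vP: "v \<in> carrier P" "v \<sqsubseteq> ?w" by (auto simp: atoms_below_def atoms_def)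
    have le: "?w \<sqsubseteq> x" "?w \<sqsubseteq> y'" using L.meet_left[OF xy(1) y'(1)] L.meet_right[OF xy(1) y'(1)] by simp_all
    have y'P: "y' \<in> carrier P" using y' by (simp add: lower_interval_def)
    have "v \<in> vs x" using v vs_mono[OF le(1) wP x(1)] by blast
    then have "v \<sqsubseteq> y" using sub by (auto simp: atoms_below_def)
    moreover have "v \<sqsubseteq> y'" by (rule le_trans[OF vP(2) le(2) vP(1) wP y'P])
    moreover have "v \<in> carrier ?L" using le_trans[OF \<open>v \<sqsubseteq> y\<close> y(2) vP(1) y(1) t] vP(1) by (simp add: lower_interval_def)
    ultimately have "v \<sqsubseteq> y \<sqinter>\<^bsub>?L\<^esub> y'"
      using L.meet_le[OF _ _ xy(2) y'(1), of v] by simp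
    then have "v \<sqsubseteq> zero_hat P" unfolding y'(3) interval_bottom[OF t] .
    then have "v = zero_hat P" using le_antisym vP(1) by simp
    then show False using v atom_not_zero by (auto simp: atoms_below_def)
  qed
  then have w0: "?w = \<bottom>\<^bsub>?L\<^esub>" using interval_bottom[OF t] by simp
  let ?m = "x \<sqinter>\<^bsub>?L\<^esub> y"
  have m: "?m \<in> carrier ?L" by (rule L.meet_closed[OF xy])
  then have mP: "?m \<in> carrier P" "\<bottom>\<^bsub>?L\<^esub> \<sqsubseteq> ?m"
    using interval_bottom[OF t] by (simp_all add: lower_interval_def)
  have x_eq: "x \<sqinter>\<^bsub>?L\<^esub> \<top>\<^bsub>?L\<^esub> = ?m \<squnion>\<^bsub>?L\<^esub> ?w" using distrib y'(2) by simp
  have "?m \<squnion>\<^bsub>?L\<^esub> ?w \<sqsubseteq> ?m"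
    using L.join_le[OF L.le_refl[OF m] _ m w m] mP(2) w0 by simp
  moreover have "x \<sqsubseteq> x \<sqinter>\<^bsub>?L\<^esub> \<top>\<^bsub>?L\<^esub>"
    using L.meet_le[OF L.le_refl[OF xy(1)] L.top_higher[OF xy(1)] xy(1) L.top_closed xy(1)] by simp
  moreover have "?m \<squnion>\<^bsub>?L\<^esub> ?w \<in> carrier P"
    using L.join_closed[OF m w] by (simp add: lower_interval_def)
  ultimately have "x \<sqsubseteq> ?m" using le_trans[of x _ ?m] x(1) mP(1) unfolding x_eq by blast
  moreover have "?m \<sqsubseteq> y" using L.meet_right[OF xy] by simp
  ultimately show ?thesis using le_trans[of x ?m y] x(1) y(1) mP(1) by blast
qed

lemma vs_inj:
  assumes "t \<in> carrier P" "x \<in> carrier P" "x \<sqsubseteq> t" "y \<in> carrier P" "y \<sqsubseteq> t" "vs x = vs y"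
  shows "x = y"
  using assms vs_subset_imp_le[of t x y] vs_subset_imp_le[of t y x] le_antisym by auto

text \<open>Atoms are joined in one at a time. The join of \<open>y\<close> and \<open>v\<close>
  acquires no further atom \<open>w\<close>: by distributivity its meet with \<open>w\<close> is the
  join of the meets of \<open>w\<close> with \<open>y\<close> and with \<open>v\<close>, and both
  are zero.\<close>

lemma vs_surj:
  assumes t: "t \<in> carrier P" and S: "S \<subseteq> vs t"
  obtains y where "y \<in> carrier P" "y \<sqsubseteq> t" "vs y = S"
proof -
  let ?L = "P\<lparr>carrier := lower_interval P t\<rparr>"
  interpret L: bounded_lattice ?L by (rule interval_bounded_lattice[OF t])
  have "boolean_algebra_on ?L" using simplicial t by (simp add: simplicial_poset_def)
  then have distrib: "x \<sqinter>\<^bsub>?L\<^esub> (y \<squnion>\<^bsub>?L\<^esub> z) = (x \<sqinter>\<^bsub>?L\<^esub> y) \<squnion>\<^bsub>?L\<^esub> (x \<sqinter>\<^bsub>?L\<^esub> z)"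
    if "x \<in> carrier ?L" "y \<in> carrier ?L" "z \<in> carrier ?L" for x y z
    using that unfolding boolean_algebra_on_def by blast
  have "finite S" using S finite_vs[OF t] finite_subset by blast
  then have "\<exists>y. y \<in> carrier P \<and> y \<sqsubseteq> t \<and> vs y = S" using S
  proof (induction S)
    case empty
    show ?case using t by (intro exI[of _ "zero_hat P"]) simp
  next
    case (insert v S)
    then obtain y where y: "y \<in> carrier P" "y \<sqsubseteq> t" "vs y = S" by auto
    have v: "v \<in> atoms P" "v \<in> carrier P" "v \<sqsubseteq> t"
      using insert.prems by (auto simp: atoms_below_def atoms_def)
    have L: "v \<in> carrier ?L" "y \<in> carrier ?L" using v y by (auto simp: lower_interval_def)
    let ?j = "y \<squnion>\<^bsub>?L\<^esub> v"
    have j: "?j \<in> carrier ?L" by (rule L.join_closed[OF L(2,1)])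
    then have jP: "?j \<in> carrier P" "?j \<sqsubseteq> t" by (auto simp: lower_interval_def)
    have le: "y \<sqsubseteq> ?j" "v \<sqsubseteq> ?j" using L.join_left[OF L(2,1)] L.join_right[OF L(2,1)] by simp_all
    have "w \<in> insert v S" if w: "w \<in> vs ?j" for w
    proof (rule ccontr)
      assume nw: "w \<notin> insert v S"
      have wa: "w \<in> atoms P" "w \<in> carrier P" "w \<sqsubseteq> ?j" using w by (auto simp: atoms_below_def atoms_def)
      have wL: "w \<in> carrier ?L" using le_trans[OF wa(3) jP(2) wa(2) jP(1) t] wa(2) by (simp add: lower_interval_def)
      have meet_zero: "w \<sqinter>\<^bsub>?L\<^esub> u = zero_hat P" if u: "u \<in> carrier ?L" "\<not> w \<sqsubseteq> u" for u
      proof -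
        have "w \<sqinter>\<^bsub>?L\<^esub> u \<in> carrier ?L" "w \<sqinter>\<^bsub>?L\<^esub> u \<sqsubseteq> w" "w \<sqinter>\<^bsub>?L\<^esub> u \<sqsubseteq> u"
          using L.meet_closed[OF wL u(1)] L.meet_left[OF wL u(1)] L.meet_right[OF wL u(1)] by simp_all
        then show ?thesis using le_atom[OF wa(1), of "w \<sqinter>\<^bsub>?L\<^esub> u"] u(2)
          by (auto simp: lower_interval_def)
      qed
      have "\<not> w \<sqsubseteq> y" using nw y(3) wa(1) by (auto simp: atoms_below_def)
      moreover have "\<not> w \<sqsubseteq> v" using le_atom[OF v(1) wa(2)] nw atom_not_zero[OF wa(1)] by auto
      ultimately have mz: "w \<sqinter>\<^bsub>?L\<^esub> y = \<bottom>\<^bsub>?L\<^esub>" "w \<sqinter>\<^bsub>?L\<^esub> v = \<bottom>\<^bsub>?L\<^esub>"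
        using meet_zero[OF L(2)] meet_zero[OF L(1)] unfolding interval_bottom[OF t] by blast+
      have "\<bottom>\<^bsub>?L\<^esub> \<squnion>\<^bsub>?L\<^esub> \<bottom>\<^bsub>?L\<^esub> \<sqsubseteq>\<^bsub>?L\<^esub> \<bottom>\<^bsub>?L\<^esub>"
        by (rule L.join_le) (rule L.le_refl L.bottom_closed)+
      then have "w \<sqinter>\<^bsub>?L\<^esub> ?j \<sqsubseteq> zero_hat P"
        unfolding distrib[OF wL L(2,1)] mz interval_bottom[OF t] by simp
      moreover have "w \<sqsubseteq> w \<sqinter>\<^bsub>?L\<^esub> ?j"
        using L.meet_le[OF L.le_refl[OF wL] _ wL j wL] wa(3) by simp
      moreover have "w \<sqinter>\<^bsub>?L\<^esub> ?j \<in> carrier P" using L.meet_closed[OF wL j] by (simp add: lower_interval_def)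
      ultimately have "w \<sqsubseteq> zero_hat P" using le_trans[OF _ _ wa(2) _ zero_closed] by blast
      then have "w = zero_hat P" using le_antisym[OF _ zero_le[OF wa(2)] wa(2) zero_closed] by blast
      then show False using atom_not_zero[OF wa(1)] by blast
    qed
    moreover have "insert v S \<subseteq> vs ?j"
      using vs_mono[OF le(1) y(1) jP(1)] y(3) v(1) le(2) by (auto simp: atoms_below_def)
    ultimately have "vs ?j = insert v S" by blast
    then show ?case using jP by blast
  qed
  then show thesis using that by blast
qed

section \<open>Minimal upper bounds and meets\<close>

lemma mub_closed: "z \<in> minimal_upper_bounds P p q \<Longrightarrow> z \<in> carrier P"
  by (simp add: minimal_upper_bounds_def minimal_elements_def Upper_def)

lemma mub_upper:
  assumes "z \<in> minimal_upper_bounds P p q" "p \<in> carrier P" "q \<in> carrier P"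
  shows "p \<sqsubseteq> z" "q \<sqsubseteq> z"
  using assms by (auto simp: minimal_upper_bounds_def minimal_elements_def Upper_def)

text \<open>Inside the Boolean interval below \<open>t\<close>, the only minimal upper bound of
  \<open>p\<close> and \<open>q\<close> is their join. Hence at most one term of the sum in a face
  relation survives in any single cell.\<close>

lemma mub_below:
  assumes p: "p \<in> carrier P" "p \<sqsubseteq> t" and q: "q \<in> carrier P" "q \<sqsubseteq> t" and t: "t \<in> carrier P"
  obtains z where "minimal_upper_bounds P p q \<inter> lower_interval P t = {z}" "vs z = vs p \<union> vs q"
proof -
  have "vs p \<union> vs q \<subseteq> vs t" using vs_mono p q t by blast
  then obtain z where z: "z \<in> carrier P" "z \<sqsubseteq> t" "vs z = vs p \<union> vs q" using vs_surj[OF t] by metis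
  have up: "p \<sqsubseteq> z" "q \<sqsubseteq> z" using vs_subset_imp_le[OF t _ _ z(1,2)] p q z(3) by auto
  have leI: "z \<sqsubseteq> y" if "y \<in> carrier P" "y \<sqsubseteq> t" "p \<sqsubseteq> y" "q \<sqsubseteq> y" for y
    using vs_subset_imp_le[OF t z(1,2) that(1,2)] vs_mono that p q z by auto
  have "z \<in> minimal_upper_bounds P p q"
    unfolding minimal_upper_bounds_def minimal_elements_def
  proof (intro CollectI conjI ballI impI)
    show "z \<in> Upper P {p, q}" using up z by (auto simp: Upper_def)
    fix y assume y: "y \<in> Upper P {p, q}" "y \<sqsubseteq> z"
    then have "y \<in> carrier P" "p \<sqsubseteq> y" "q \<sqsubseteq> y" using p q by (auto simp: Upper_def)
    then show "y = z" using leI[of y] y z t le_trans[of y z t] le_antisym by auto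
  qed
  moreover have "y = z" if y: "y \<in> minimal_upper_bounds P p q" "y \<sqsubseteq> t" for y
  proof -
    have "z \<sqsubseteq> y" using leI mub_closed mub_upper y p q by blast
    moreover have "z \<in> Upper P {p, q}" using up z by (auto simp: Upper_def)
    ultimately show ?thesis using y by (auto simp: minimal_upper_bounds_def minimal_elements_def)
  qed
  ultimately have "minimal_upper_bounds P p q \<inter> lower_interval P t = {z}"
    using z(1,2) unfolding lower_interval_def by blast
  then show thesis using that z(3) by blast
qed

text \<open>Apply \<open>mub_below\<close> to the interval below \<open>z\<close> itself.\<close>

lemma vs_mub:
  assumes "z \<in> minimal_upper_bounds P p q" "p \<in> carrier P" "q \<in> carrier P"
  shows "vs z = vs p \<union> vs q"
proof -
  have z: "z \<in> carrier P" "p \<sqsubseteq> z" "q \<sqsubseteq> z" using assms mub_closed mub_upper by auto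
  obtain y where "minimal_upper_bounds P p q \<inter> lower_interval P z = {y}" "vs y = vs p \<union> vs q"
    using mub_below assms z by metis
  then show ?thesis using assms(1) z by (auto simp: lower_interval_def)
qed

text \<open>A lower bound of \<open>p\<close> is automatically below \<open>t\<close>, so the meet
  found in the interval is a meet in all of \<open>P\<close>. The choice operator behind the meet
  symbol then has a witness.\<close>

lemma meet_greatest:
  assumes p: "p \<in> carrier P" "p \<sqsubseteq> t" and q: "q \<in> carrier P" "q \<sqsubseteq> t" and t: "t \<in> carrier P"
  shows "greatest P (p \<sqinter> q) (Lower P {p, q})"
proof -
  have "vs p \<inter> vs q \<subseteq> vs t" using vs_mono p t by blast
  then obtain w where w: "w \<in> carrier P" "w \<sqsubseteq> t" "vs w = vs p \<inter> vs q" using vs_surj[OF t] by metis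
  have "greatest P w (Lower P {p, q})"
    unfolding greatest_def
  proof (intro conjI ballI)
    show "w \<in> Lower P {p, q}" "Lower P {p, q} \<subseteq> carrier P"
      using vs_subset_imp_le[OF t w(1,2)] w p q by (auto simp: Lower_def)
    fix y assume "y \<in> Lower P {p, q}"
    then have y: "y \<in> carrier P" "y \<sqsubseteq> p" "y \<sqsubseteq> q" using p q by (auto simp: Lower_def)
    have "vs y \<subseteq> vs w" using vs_mono[OF y(2,1) p(1)] vs_mono[OF y(3,1) q(1)] w(3) by blast
    then show "y \<sqsubseteq> w"
      by (rule vs_subset_imp_le[OF t y(1) le_trans[OF y(2) p(2) y(1) p(1) t] w(1,2)])
  qed
  then show ?thesis unfolding meet_def inf_def by (rule someI)
qed

lemma meet_props:
  assumes p: "p \<in> carrier P" "p \<sqsubseteq> t" and q: "q \<in> carrier P" "q \<sqsubseteq> t" and t: "t \<in> carrier P"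
  shows "p \<sqinter> q \<in> carrier P" "p \<sqinter> q \<sqsubseteq> p" "p \<sqinter> q \<sqsubseteq> q" "vs (p \<sqinter> q) = vs p \<inter> vs q"
proof -
  note g = meet_greatest[OF assms]
  show c: "p \<sqinter> q \<in> carrier P" and l: "p \<sqinter> q \<sqsubseteq> p" "p \<sqinter> q \<sqsubseteq> q"
    using g p q by (auto simp: greatest_def Lower_def)
  have "v \<sqsubseteq> p \<sqinter> q" if "v \<in> vs p" "v \<in> vs q" for v
    using g that p q by (auto simp: greatest_def Lower_def atoms_below_def atoms_def)
  then show "vs (p \<sqinter> q) = vs p \<inter> vs q"
    using vs_mono[OF l(1) c p(1)] vs_mono[OF l(2) c q(1)] by (auto simp: atoms_below_def)
qed

end

abbreviation keys where "keys \<equiv> Poly_Mapping.keys"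
abbreviation lookup where "lookup \<equiv> Poly_Mapping.lookup"
abbreviation monomial where "monomial \<equiv> Poly_Mapping.single"

section \<open>Ideals of polynomial rings\<close>

lemma mpoly_ring_a_inv:
  assumes "f \<in> carrier (mpoly_ring k V)"
  shows "\<ominus>\<^bsub>mpoly_ring k V\<^esub> f = - f"
proof -
  interpret cring "mpoly_ring k V" by (rule cring_mpoly_ring)
  show ?thesis
    by (rule minus_equality) (use assms in \<open>auto simp: mpoly_ring_simps(2-) mpoly_uminus_closed\<close>)
qed

lemma mpoly_ring_a_minus:
  assumes "g \<in> carrier (mpoly_ring k V)"
  shows "f \<ominus>\<^bsub>mpoly_ring k V\<^esub> g = f - g"
  using assms by (simp add: a_minus_def mpoly_ring_a_inv mpoly_ring_simps(2-))

lemma mpoly_diff_closed: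
  assumes "f \<in> carrier (mpoly_ring k V)" "g \<in> carrier (mpoly_ring k V)"
  shows "f - g \<in> carrier (mpoly_ring k V)"
  using mpoly_add_closed[OF assms(1) mpoly_uminus_closed[OF assms(2)]] by simp

lemma mpoly_single_closed: "keys m \<subseteq> V \<Longrightarrow> Poly_Mapping.single m c \<in> carrier (mpoly_ring k V)"
  by (auto simp: mpoly_ring_simps)

lemma ideal_mpolyI:
  assumes sub: "I \<subseteq> carrier (mpoly_ring k V)" and zero: "0 \<in> I"
    and add: "\<And>f g. f \<in> I \<Longrightarrow> g \<in> I \<Longrightarrow> f + g \<in> I"
    and mult: "\<And>f h. f \<in> I \<Longrightarrow> h \<in> carrier (mpoly_ring k V) \<Longrightarrow> h * f \<in> I"
  shows "ideal I (mpoly_ring k V)"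
proof (rule idealI[OF ring_mpoly_ring])
  have "- f \<in> I" if "f \<in> I" for f
    using mult[OF that mpoly_uminus_closed[OF mpoly_one_closed]] by simp
  then have "inv\<^bsub>add_monoid (mpoly_ring k V)\<^esub> f \<in> I" if "f \<in> I" for f
    using that sub mpoly_ring_a_inv[of f k V] unfolding a_inv_def by auto
  then show "subgroup I (add_monoid (mpoly_ring k V))"
    using sub zero add by (intro subgroup.intro) (auto simp: mpoly_ring_simps(2-))
qed (use mult in \<open>auto simp: mpoly_ring_simps(2) mult.commute\<close>)

lemma mpoly_ideal_closed:
  assumes "ideal I (mpoly_ring k V)"
  shows mpoly_ideal_zero: "0 \<in> I"
    and mpoly_ideal_add: "f \<in> I \<Longrightarrow> g \<in> I \<Longrightarrow> f + g \<in> I"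
    and mpoly_ideal_mult: "f \<in> I \<Longrightarrow> h \<in> carrier (mpoly_ring k V) \<Longrightarrow> h * f \<in> I"
    and mpoly_ideal_uminus: "f \<in> I \<Longrightarrow> - f \<in> I"
    and mpoly_ideal_diff: "f \<in> I \<Longrightarrow> g \<in> I \<Longrightarrow> f - g \<in> I"
proof -
  interpret ideal I "mpoly_ring k V" by (rule assms)
  show "0 \<in> I" using additive_subgroup.zero_closed[OF is_additive_subgroup]
    by (simp add: mpoly_ring_simps(5))
  show add: "f + g \<in> I" if "f \<in> I" "g \<in> I" for f g
    using additive_subgroup.a_closed[OF is_additive_subgroup that] by (simp add: mpoly_ring_simps(3))
  show mult: "h * f \<in> I" if "f \<in> I" "h \<in> carrier (mpoly_ring k V)" for f h
    using I_l_closed[OF that] by (simp add: mpoly_ring_simps(2))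
  have neg: "- f \<in> I" if "f \<in> I" for f
    using mult[OF that mpoly_uminus_closed[OF mpoly_one_closed]] by simp
  then show "f \<in> I \<Longrightarrow> - f \<in> I" .
  show "f - g \<in> I" if "f \<in> I" "g \<in> I" using add[OF that(1) neg[OF that(2)]] by simp
qed

lemma mpoly_ideal_sum:
  assumes "ideal I (mpoly_ring k V)" "\<And>i. i \<in> A \<Longrightarrow> f i \<in> I"
  shows "sum f A \<in> I"
  using assms(2) by (induction A rule: infinite_finite_induct)
    (auto intro: mpoly_ideal_zero[OF assms(1)] mpoly_ideal_add[OF assms(1)])

lemma mpoly_coset_eq_iff:
  assumes "ideal I (mpoly_ring k V)" "f \<in> carrier (mpoly_ring k V)" "g \<in> carrier (mpoly_ring k V)"
  shows "I +>\<^bsub>mpoly_ring k V\<^esub> f = I +>\<^bsub>mpoly_ring k V\<^esub> g \<longleftrightarrow> f - g \<in> I"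
  using ring.quotient_eq_iff_same_a_r_cos[OF ring_mpoly_ring assms] mpoly_ring_a_minus[OF assms(3)]
  by simp

section \<open>Monomials\<close>

lemma prod_monomial: "(\<Prod>i\<in>I. monomial (h i) (1 :: 'k::field)) = monomial (\<Sum>i\<in>I. h i) 1"
  by (induction I rule: infinite_finite_induct) (auto simp: mult_single)

lemma power_monomial: "monomial a (1 :: 'k::field) ^ j = monomial (\<Sum>i<j. a) 1"
  using prod_monomial[of "\<lambda>_. a" "{..<j}"] by simp

text \<open>The exponent vector of the squarefree monomial on \<open>S\<close>. For infinite
  \<open>S\<close> the sum defaults to 0, which is why finiteness is assumed in the lemmas that read
  off its entries.\<close>

definition ind :: "'v set \<Rightarrow> 'v \<Rightarrow>\<^sub>0 nat" where
  "ind S = (\<Sum>v\<in>S. monomial v 1)"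

lemma lookup_ind: "finite S \<Longrightarrow> lookup (ind S) v = (if v \<in> S then 1 else 0)"
  by (simp add: ind_def lookup_sum lookup_single when_def)

lemma keys_ind: "finite S \<Longrightarrow> keys (ind S) = S"
  by (rule Set.set_eqI) (simp add: in_keys_iff lookup_ind)

lemma prod_mvar: "(\<Prod>v\<in>S. mvar v :: ('v, 'k::field) mpoly) = monomial (ind S) 1"
  unfolding mvar_def ind_def by (rule prod_monomial)

text \<open>Truncated subtraction loses nothing here: every variable in the support has exponent at
  least 1.\<close>

lemma ind_keys_add: "ind (keys m) + (m - ind (keys m)) = m"
  by (rule poly_mapping_eqI) (auto simp: lookup_add lookup_minus lookup_ind in_keys_iff)

lemma prod_mvar_power:
  "(\<Prod>v\<in>keys n. mvar v ^ lookup n v :: ('v, 'k::field) mpoly) = monomial n 1"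
proof -
  have "(\<Sum>v\<in>keys n. \<Sum>i<lookup n v. monomial v 1) = n"
    by (rule poly_mapping_eqI) (auto simp: lookup_sum lookup_single when_def in_keys_iff if_distrib
        cong: if_cong)
  then show ?thesis unfolding mvar_def power_monomial prod_monomial by simp
qed

lemma mconst_mult_monomial: "mconst c * monomial n 1 = monomial n c"
  by (simp add: mconst_def mult_single)

lemma msubst_restrict_monomial:
  "msubst (\<lambda>v. if v \<in> V then mvar v else 0) (monomial n c) = (if keys n \<subseteq> V then monomial n c else 0)"
proof (cases "keys n \<subseteq> V")
  case True
  then have "(\<Prod>v\<in>keys n. (if v \<in> V then mvar v else 0) ^ lookup n v) = monomial n (1 :: 'b)"
    unfolding prod_mvar_power[symmetric] by (intro prod.cong) auto
  then show ?thesis using True by (simp add: msubst_single mconst_mult_monomial)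
next
  case False
  then obtain v where "v \<in> keys n" "v \<notin> V" by auto
  then have "(\<Prod>v\<in>keys n. (if v \<in> V then mvar v else 0 :: ('a, 'b) mpoly) ^ lookup n v) = 0"
    by (intro prod_zero bexI[of _ v]) (auto simp: in_keys_iff power_0_left)
  then show ?thesis using False by (simp add: msubst_single)
qed

lemma msubst_monomials: "msubst g f = (\<Sum>n\<in>keys f. msubst g (monomial n (lookup f n)))"
  by (subst mpoly_monomials[of f]) (rule msubst_sum)

lemma lookup_msubst_restrict:
  "lookup (msubst (\<lambda>v. if v \<in> V then mvar v else 0) f) m = (if keys m \<subseteq> V then lookup f m else 0)"
proof -
  have "lookup (msubst (\<lambda>v. if v \<in> V then mvar v else 0) f) m =
      (\<Sum>n\<in>keys f. if n = m then if keys m \<subseteq> V then lookup f m else 0 else 0)"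
    unfolding msubst_monomials[of _ f] msubst_restrict_monomial lookup_sum
    by (intro sum.cong) (auto simp: lookup_single)
  then show ?thesis by (auto simp: in_keys_iff)
qed

section \<open>Stanley--Reisner ideals and the substitution of faces\<close>

context simplicial
begin

text \<open>This isolates the properties shared by the members of X(P) on which the arguments rest.
  The common bound \<open>t\<close> is what makes an element of \<open>\<aa>\<close> determined by
  its atoms.\<close>

definition complex_in :: "'a set \<Rightarrow> bool" where
  "complex_in \<aa> \<longleftrightarrow> (\<exists>t\<in>carrier P. \<aa> \<subseteq> lower_interval P t) \<and>
     (\<forall>x\<in>\<aa>. lower_interval P x \<subseteq> \<aa>) \<and> \<aa> \<noteq> {}"

lemma complex_inE:
  assumes "complex_in \<aa>"
  obtains t where "t \<in> carrier P" "\<And>x. x \<in> \<aa> \<Longrightarrow> x \<in> carrier P \<and> x \<sqsubseteq> t"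
  using assms by (auto simp: complex_in_def lower_interval_def)

lemma complex_in_lower: "complex_in \<aa> \<Longrightarrow> x \<in> \<aa> \<Longrightarrow> y \<in> carrier P \<Longrightarrow> y \<sqsubseteq> x \<Longrightarrow> y \<in> \<aa>"
  by (auto simp: complex_in_def lower_interval_def)

lemma complex_in_zero: "complex_in \<aa> \<Longrightarrow> zero_hat P \<in> \<aa>"
  using complex_in_lower[of \<aa> _ "zero_hat P"] by (metis all_not_in_conv complex_inE complex_in_def
      zero_closed zero_le)

lemma complex_in_vs: "complex_in \<aa> \<Longrightarrow> x \<in> \<aa> \<Longrightarrow> vs x \<subseteq> atoms P \<inter> \<aa>"
  using complex_in_lower[of \<aa> x] atom_closed by (auto simp: atoms_below_def)

lemma complex_in_vs_subset:
  assumes \<aa>: "complex_in \<aa>" and x: "x \<in> \<aa>" and S: "S \<subseteq> vs x"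
  shows "S \<in> vs ` \<aa>"
proof -
  have "x \<in> carrier P" using \<aa> x by (metis complex_inE)
  then obtain y where "y \<in> carrier P" "y \<sqsubseteq> x" "vs y = S" using vs_surj S by metis
  then show ?thesis using complex_in_lower[OF \<aa> x] by blast
qed

text \<open>The ideal is a monomial ideal. Subsets of faces are faces, so the polynomials without
  face-supported monomials form an ideal, and it contains the generators. Conversely, a monomial
  whose support is not a face is divisible by the squarefree monomial on that support, which is a
  generator.\<close>

lemma SR_ideal_iff:
  assumes \<aa>: "complex_in \<aa>"
  shows "f \<in> SR_ideal k P \<aa> \<longleftrightarrow>
    f \<in> carrier (mpoly_ring k (atoms P \<inter> \<aa>)) \<and> (\<forall>m\<in>keys f. keys m \<notin> vs ` \<aa>)"
proof
  let ?R = "mpoly_ring k (atoms P \<inter> \<aa>)"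
  let ?J = "{f \<in> carrier ?R. \<forall>m\<in>keys f. keys m \<notin> vs ` \<aa>}"
  have "ideal ?J ?R"
  proof (rule ideal_mpolyI)
    fix f g assume "f \<in> ?J" "g \<in> ?J"
    then show "f + g \<in> ?J" using mpoly_add_closed[of f k _ g] keys_add[of f g] by blast
  next
    fix f h assume f: "f \<in> ?J" and h: "h \<in> carrier ?R"
    have "keys m \<notin> vs ` \<aa>" if m: "m \<in> keys (h * f)" for m
    proof
      assume "keys m \<in> vs ` \<aa>"
      then obtain x where x: "x \<in> \<aa>" "keys m = vs x" by blast
      obtain a b where "a \<in> keys h" "b \<in> keys f" "m = a + b"
        using subsetD[OF keys_mult m] by blast
      then have "keys b \<subseteq> vs x" "keys b \<notin> vs ` \<aa>" using f x by (auto simp: keys_exponent_add)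
      then show False using complex_in_vs_subset[OF \<aa> x(1)] by blast
    qed
    then show "h * f \<in> ?J" using mpoly_mult_closed h f by blast
  qed (auto simp: mpoly_zero_closed)
  moreover have "{\<Prod>v\<in>\<sigma>. mvar v | \<sigma>. \<sigma> \<subseteq> atoms P \<inter> \<aa> \<and> \<sigma> \<notin> vs ` \<aa>} \<subseteq> ?J"
  proof (rule subsetI)
    fix g :: "('a, 'c) mpoly"
    assume g: "g \<in> {\<Prod>v\<in>\<sigma>. mvar v | \<sigma>. \<sigma> \<subseteq> atoms P \<inter> \<aa> \<and> \<sigma> \<notin> vs ` \<aa>}"
    then obtain \<sigma> where \<sigma>: "g = (\<Prod>v\<in>\<sigma>. mvar v)" "\<sigma> \<subseteq> atoms P \<inter> \<aa>" "\<sigma> \<notin> vs ` \<aa>" by blast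
    obtain t where t: "t \<in> carrier P" "\<And>x. x \<in> \<aa> \<Longrightarrow> x \<in> carrier P \<and> x \<sqsubseteq> t"
      using complex_inE[OF \<aa>] by blast
    \<comment> \<open>Finiteness of \<open>\<sigma>\<close> matters: over an infinite set the
      product would collapse to 1.\<close>
    have "\<sigma> \<subseteq> vs t" using \<sigma>(2) t(2) by (auto simp: atoms_below_def)
    then have "finite \<sigma>" using finite_vs[OF t(1)] finite_subset by blast
    then show "g \<in> ?J" using \<sigma> SR_gens_subset[of P \<aa> k] g
      by (auto simp: prod_mvar keys_ind)
  qed
  ultimately have "SR_ideal k P \<aa> \<subseteq> ?J"
    unfolding SR_ideal_def by (intro ring.genideal_minimal[OF ring_mpoly_ring])
  then show "f \<in> SR_ideal k P \<aa> \<Longrightarrow> f \<in> carrier ?R \<and> (\<forall>m\<in>keys f. keys m \<notin> vs ` \<aa>)" by blast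
  assume f: "f \<in> carrier ?R \<and> (\<forall>m\<in>keys f. keys m \<notin> vs ` \<aa>)"
  have "monomial m c \<in> SR_ideal k P \<aa>" if m: "m \<in> keys f" for m c
  proof -
    have m': "keys m \<subseteq> atoms P \<inter> \<aa>" "keys m \<notin> vs ` \<aa>" using f m by (auto simp: mpoly_ring_simps)
    then have "(\<Prod>v\<in>keys m. mvar v) \<in> SR_ideal k P \<aa>"
      unfolding SR_ideal_def
      by (intro subsetD[OF ring.genideal_self[OF ring_mpoly_ring SR_gens_subset]]) blast
    moreover have "keys (m - ind (keys m)) \<subseteq> atoms P \<inter> \<aa>"
      using m'(1) keys_diff[of m "ind (keys m)"] by (auto simp: keys_ind)
    ultimately have "monomial (m - ind (keys m)) c * monomial (ind (keys m)) 1 \<in> SR_ideal k P \<aa>"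
      unfolding prod_mvar by (intro mpoly_ideal_mult[OF ideal_SR_ideal] mpoly_single_closed)
    then show ?thesis by (simp add: mult_single add.commute ind_keys_add)
  qed
  then show "f \<in> SR_ideal k P \<aa>"
    by (subst mpoly_monomials) (rule mpoly_ideal_sum[OF ideal_SR_ideal])
qed

text \<open>An element of the ring at \<open>\<aa>\<close> is thus determined by its coefficients at
  monomials supported on faces. Equalities of cosets are checked in this form from here on.\<close>

lemma SR_coset_eq_iff:
  assumes \<aa>: "complex_in \<aa>"
    and f: "f \<in> carrier (mpoly_ring k (atoms P \<inter> \<aa>))" and g: "g \<in> carrier (mpoly_ring k (atoms P \<inter> \<aa>))"
  shows "SR_ideal k P \<aa> +>\<^bsub>mpoly_ring k (atoms P \<inter> \<aa>)\<^esub> f = SR_ideal k P \<aa> +>\<^bsub>mpoly_ring k (atoms P \<inter> \<aa>)\<^esub> g \<longleftrightarrow>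
    (\<forall>m. keys m \<in> vs ` \<aa> \<longrightarrow> lookup f m = lookup g m)"
  unfolding mpoly_coset_eq_iff[OF ideal_SR_ideal f g] SR_ideal_iff[OF \<aa>]
  using mpoly_diff_closed[OF f g] unfolding Ball_def in_keys_iff lookup_minus by auto

section \<open>Substituting squarefree monomials in the atoms for the elements of the poset\<close>

definition face_subst :: "'a set \<Rightarrow> ('a, 'k) mpoly \<Rightarrow> ('a, 'k::field) mpoly" where
  "face_subst \<aa> = msubst (\<lambda>p. if p \<in> \<aa> then \<Prod>v\<in>vs p. mvar v else 0)"

lemma face_subst_closed:
  assumes "complex_in \<aa>"
  shows "face_subst \<aa> f \<in> carrier (mpoly_ring k (atoms P \<inter> \<aa>))"
  unfolding face_subst_def
  using complex_in_vs[OF assms]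
  by (intro msubst_closed) (auto intro!: mpoly_prod_closed mpoly_var_closed mpoly_zero_closed)

lemma face_subst_simps:
  "face_subst \<aa> (f + g) = face_subst \<aa> f + face_subst \<aa> g"
  "face_subst \<aa> (f * g) = face_subst \<aa> f * face_subst \<aa> g"
  "face_subst \<aa> (sum h A) = (\<Sum>i\<in>A. face_subst \<aa> (h i))"
  "face_subst \<aa> 0 = 0" "face_subst \<aa> 1 = 1"
  "face_subst \<aa> (mvar p) = (if p \<in> \<aa> then monomial (ind (vs p)) 1 else 0)"
  by (simp_all add: face_subst_def msubst_add msubst_mult msubst_sum msubst_zero msubst_one
      msubst_var prod_mvar)

lemma face_subst_uminus: "face_subst \<aa> (- f) = - face_subst \<aa> f"
  using face_subst_simps(1)[of \<aa> f "- f"] by (simp add: face_subst_simps minus_unique)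

lemma face_subst_diff: "face_subst \<aa> (f - g) = face_subst \<aa> f - face_subst \<aa> g"
  using face_subst_simps(1)[of \<aa> f "- g"] by (simp add: face_subst_uminus)

text \<open>The exponent of the image of the monomial \<open>n\<close>. The inner sum of a constant
  is multiplication by the number \<open>lookup n p\<close>. The cell does not enter: it only
  decides whether the image survives.\<close>

definition expo :: "('a \<Rightarrow>\<^sub>0 nat) \<Rightarrow> 'a \<Rightarrow>\<^sub>0 nat" where
  "expo n = (\<Sum>p\<in>keys n. \<Sum>i<lookup n p. ind (vs p))"

lemma face_subst_monomial:
  "face_subst \<aa> (monomial n c) = (if keys n \<subseteq> \<aa> then monomial (expo n) c else 0)"
proof (cases "keys n \<subseteq> \<aa>")
  case True
  then have "(\<Prod>p\<in>keys n. (if p \<in> \<aa> then \<Prod>v\<in>vs p. mvar v else 0) ^ lookup n p) =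
      (\<Prod>p\<in>keys n. monomial (ind (vs p)) 1 ^ lookup n p :: ('a, 'c) mpoly)"
    by (intro prod.cong) (auto simp: prod_mvar)
  also have "\<dots> = monomial (expo n) 1"
    unfolding power_monomial prod_monomial expo_def ..
  finally show ?thesis using True by (simp add: face_subst_def msubst_single mconst_mult_monomial)
next
  case False
  then obtain v where "v \<in> keys n" "v \<notin> \<aa>" by auto
  then have "(\<Prod>p\<in>keys n. (if p \<in> \<aa> then \<Prod>v\<in>vs p. mvar v else 0 :: ('a, 'c) mpoly) ^ lookup n p) = 0"
    by (intro prod_zero bexI[of _ v]) (auto simp: in_keys_iff power_0_left)
  then show ?thesis using False by (simp add: face_subst_def msubst_single)
qed

text \<open>The coefficient at \<open>m\<close> collects the fibre of \<open>expo\<close> over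
  \<open>m\<close>. Comparing images thereby becomes a question of which monomials lie in that
  fibre.\<close>

lemma lookup_face_subst:
  "lookup (face_subst \<aa> f) m = (\<Sum>n\<in>{n \<in> keys f. keys n \<subseteq> \<aa> \<and> expo n = m}. lookup f n)"
proof -
  have "lookup (face_subst \<aa> f) m = (\<Sum>n\<in>keys f. lookup (face_subst \<aa> (monomial n (lookup f n))) m)"
    unfolding face_subst_def msubst_monomials[of _ f] by (rule lookup_sum)
  also have "\<dots> = (\<Sum>n\<in>keys f. if keys n \<subseteq> \<aa> \<and> expo n = m then lookup f n else 0)"
    by (intro sum.cong) (auto simp: face_subst_monomial lookup_single)
  finally show ?thesis by (simp add: sum.If_cases Collect_conj_eq)
qed

lemma lookup_expo:
  assumes "keys n \<subseteq> carrier P"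
  shows "lookup (expo n) v = (\<Sum>p\<in>{p \<in> keys n. v \<in> vs p}. lookup n p)"
proof -
  have "lookup (expo n) v = (\<Sum>p\<in>keys n. if v \<in> vs p then lookup n p else 0)"
    unfolding expo_def lookup_sum using assms finite_vs
    by (intro sum.cong) (auto simp: lookup_ind subset_iff)
  then show ?thesis by (simp add: sum.If_cases Collect_conj_eq)
qed

lemma keys_expo:
  assumes "keys n \<subseteq> carrier P"
  shows "keys (expo n) = (\<Union>p\<in>keys n. vs p)"
proof (rule Set.set_eqI)
  fix v
  have "v \<in> keys (expo n) \<longleftrightarrow> (\<exists>p\<in>{p \<in> keys n. v \<in> vs p}. lookup n p \<noteq> 0)"
    by (subst in_keys_iff) (simp add: lookup_expo[OF assms])
  then show "v \<in> keys (expo n) \<longleftrightarrow> v \<in> (\<Union>p\<in>keys n. vs p)"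
    unfolding in_keys_iff[of _ n, symmetric] by auto
qed

lemma expo_add: "expo (n + n') = expo n + expo n'"
proof -
  have expo: "expo n = (\<Sum>p\<in>keys n \<union> keys n'. \<Sum>i<lookup n p. ind (vs p))"
    if "keys n \<subseteq> keys n \<union> keys n'" for n n'
    unfolding expo_def by (intro sum.mono_neutral_left) (auto simp: in_keys_iff)
  have split: "(\<Sum>i<a+b. c) = (\<Sum>i<a. c) + (\<Sum>i<b. c)" for a b :: nat and c :: "'a \<Rightarrow>\<^sub>0 nat"
    by (rule poly_mapping_eqI) (simp add: lookup_sum lookup_add algebra_simps)
  show ?thesis
    using expo[of n n'] expo[of n' n]
    by (simp add: expo_def keys_exponent_add lookup_add split sum.distrib Un_commute)
qed

lemma expo_single: "expo (monomial p 1) = ind (vs p)"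
  by (simp add: expo_def)

lemma expo_atoms:
  assumes "keys n \<subseteq> atoms P"
  shows "expo n = n"
proof (rule poly_mapping_eqI)
  fix v
  have "{p \<in> keys n. v \<in> vs p} = (if v \<in> keys n then {v} else {})"
    using assms by (auto simp: vs_atom subset_iff)
  moreover have "keys n \<subseteq> carrier P" using assms atom_closed by blast
  ultimately show "lookup (expo n) v = lookup n v"
    by (auto simp: lookup_expo in_keys_iff)
qed

section \<open>Global sections\<close>

lemma complex_in_max_intersections:
  assumes "\<aa> \<in> max_intersections P"
  shows "complex_in \<aa>"
proof -
  obtain \<tau> where \<tau>: "\<aa> = ideal_meet P \<tau>" "\<tau> \<noteq> {}" "\<tau> \<subseteq> carrier P"
    using assms by (auto simp: max_intersections_def maximal_elements_def)
  then obtain t where t: "t \<in> \<tau>" by blast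
  have "lower_interval P x \<subseteq> \<aa>" if x: "x \<in> \<aa>" for x
  proof
    fix y assume y: "y \<in> lower_interval P x"
    have "y \<sqsubseteq> s" if "s \<in> \<tau>" for s
      using le_trans[of y x s] x y \<tau> that by (auto simp: ideal_meet_def lower_interval_def)
    then show "y \<in> \<aa>" using y \<tau>(1) by (auto simp: ideal_meet_def lower_interval_def)
  qed
  moreover have "zero_hat P \<in> \<aa>" using \<tau> by (auto simp: ideal_meet_def lower_interval_def)
  ultimately show ?thesis using \<tau> t by (auto simp: complex_in_def ideal_meet_def)
qed

lemma lower_interval_max_intersections:
  "t \<in> maximal_elements P (carrier P) \<Longrightarrow> lower_interval P t \<in> max_intersections P"
  unfolding max_intersections_def by (auto simp: ideal_meet_def intro!: exI[of _ "{t}"])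

lemma msubst_restrict_closed:
  assumes "f \<in> carrier (mpoly_ring k V)"
  shows "msubst (\<lambda>v. if v \<in> W then mvar v else 0) f \<in> carrier (mpoly_ring k (V \<inter> W))"
proof -
  have "m \<in> keys f \<and> keys m \<subseteq> W" if "m \<in> keys (msubst (\<lambda>v. if v \<in> W then mvar v else 0) f)" for m
    using that lookup_msubst_restrict[of W f m] by (metis in_keys_iff)
  then show ?thesis using assms unfolding mpoly_ring_simps(1) by blast
qed

text \<open>The projection deletes exactly the monomials with a variable outside
  \<open>\<bb>\<close>. Those supported on a face of \<open>\<bb>\<close> only involve variables in
  \<open>\<bb>\<close>, so their coefficients are untouched.\<close>

lemma SR_proj_eq_iff:
  assumes \<aa>: "\<aa> \<in> max_intersections P" and \<bb>: "\<bb> \<in> max_intersections P" and sub: "\<bb> \<subseteq> \<aa>"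
    and f: "f \<in> carrier (mpoly_ring k (atoms P \<inter> \<aa>))" and g: "g \<in> carrier (mpoly_ring k (atoms P \<inter> \<bb>))"
  shows "SR_proj k P \<aa> \<bb> (SR_ideal k P \<aa> +>\<^bsub>mpoly_ring k (atoms P \<inter> \<aa>)\<^esub> f) =
      SR_ideal k P \<bb> +>\<^bsub>mpoly_ring k (atoms P \<inter> \<bb>)\<^esub> g \<longleftrightarrow>
    (\<forall>m. keys m \<in> vs ` \<bb> \<longrightarrow> lookup f m = lookup g m)"
proof -
  have "atoms P \<inter> \<aa> \<inter> \<bb> = atoms P \<inter> \<bb>" using sub by blast
  then have closed: "msubst (\<lambda>v. if v \<in> \<bb> then mvar v else 0) f \<in> carrier (mpoly_ring k (atoms P \<inter> \<bb>))"
    using msubst_restrict_closed[OF f, of \<bb>] by simp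
  have "keys m \<subseteq> \<bb>" if "keys m \<in> vs ` \<bb>" for m :: "'a \<Rightarrow>\<^sub>0 nat"
    using that complex_in_vs[OF complex_in_max_intersections[OF \<bb>]] by auto
  then show ?thesis
    unfolding SR_proj_coset[OF sub finite_max_intersections[OF simplicial \<aa>] f]
      SR_coset_eq_iff[OF complex_in_max_intersections[OF \<bb>] closed g] lookup_msubst_restrict
    by auto
qed

section \<open>The homomorphism from polynomials to global sections\<close>

lemma SR_ring_carrier:
  "carrier (SR_ring k P \<aa>) = (\<lambda>f. SR_ideal k P \<aa> +>\<^bsub>mpoly_ring k (atoms P \<inter> \<aa>)\<^esub> f) `
     carrier (mpoly_ring k (atoms P \<inter> \<aa>))"
  by (auto simp: SR_ring_def FactRing_def A_RCOSETS_def')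

definition face_sections :: "'k itself \<Rightarrow> ('a, 'k::field) mpoly \<Rightarrow> 'a set \<Rightarrow> ('a, 'k) mpoly set" where
  "face_sections k f = (\<lambda>\<aa>\<in>max_intersections P.
     SR_ideal k P \<aa> +>\<^bsub>mpoly_ring k (atoms P \<inter> \<aa>)\<^esub> face_subst \<aa> f)"

text \<open>Suppose \<open>n\<close> lives on \<open>\<aa>\<close> and maps to an exponent supported
  on the atoms of some \<open>x\<close> in \<open>\<bb>\<close>. Each variable \<open>p\<close> of
  \<open>n\<close> then has its atoms among those of \<open>x\<close>, so \<open>p\<close> is below
  \<open>x\<close> and lies in \<open>\<bb>\<close>. The fibres of \<open>expo\<close> over
  \<open>m\<close> are therefore the same for both cells.\<close>

lemma lookup_face_subst_mono:
  assumes \<aa>: "complex_in \<aa>" and \<bb>: "complex_in \<bb>" and sub: "\<bb> \<subseteq> \<aa>"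
    and m: "keys m \<in> vs ` \<bb>"
  shows "lookup (face_subst \<aa> f) m = lookup (face_subst \<bb> f) m"
proof -
  obtain x where x: "x \<in> \<bb>" "keys m = vs x" using m by blast
  obtain t where t: "t \<in> carrier P" "\<And>x. x \<in> \<aa> \<Longrightarrow> x \<in> carrier P \<and> x \<sqsubseteq> t"
    using complex_inE[OF \<aa>] by blast
  have "keys n \<subseteq> \<bb>" if n: "keys n \<subseteq> \<aa>" "expo n = m" for n
  proof
    fix p assume p: "p \<in> keys n"
    have "keys n \<subseteq> carrier P" using n(1) t(2) by blast
    note n_keys = keys_expo[OF this]
    have "vs p \<subseteq> vs x" using p n(2) x(2) n_keys by auto
    moreover have "x \<in> \<aa>" "p \<in> \<aa>" using x(1) sub p n(1) by blast+
    moreover from this have "x \<in> carrier P" "x \<sqsubseteq> t" "p \<in> carrier P" "p \<sqsubseteq> t" using t(2) by auto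
    ultimately have "p \<sqsubseteq> x" using vs_subset_imp_le[OF t(1)] by simp
    then show "p \<in> \<bb>" using complex_in_lower[OF \<bb> x(1) \<open>p \<in> carrier P\<close>] by simp
  qed
  then have "{n \<in> keys f. keys n \<subseteq> \<aa> \<and> expo n = m} = {n \<in> keys f. keys n \<subseteq> \<bb> \<and> expo n = m}"
    using sub by blast
  then show ?thesis unfolding lookup_face_subst by simp
qed

lemma face_sections_closed:
  "face_sections k f \<in> carrier (sections_ring k P)"
proof -
  have "SR_proj k P \<aa> \<bb> (face_sections k f \<aa>) = face_sections k f \<bb>"
    if \<aa>: "\<aa> \<in> max_intersections P" and \<bb>: "\<bb> \<in> max_intersections P" and sub: "\<bb> \<subseteq> \<aa>" for \<aa> \<bb>
  proof -
    note c = complex_in_max_intersections[OF \<aa>] complex_in_max_intersections[OF \<bb>]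
    show ?thesis
      using SR_proj_eq_iff[OF \<aa> \<bb> sub face_subst_closed[OF c(1)] face_subst_closed[OF c(2)], of k f f]
        lookup_face_subst_mono[OF c sub, of _ f] \<aa> \<bb> by (simp add: face_sections_def)
  qed
  moreover have "face_sections k f \<aa> \<in> carrier (SR_ring k P \<aa>)" if "\<aa> \<in> max_intersections P" for \<aa>
    using imageI[OF face_subst_closed[OF complex_in_max_intersections[OF that]]] that
    by (simp add: SR_ring_carrier face_sections_def)
  ultimately show ?thesis
    by (auto simp: sections_ring_def face_sections_def)
qed

lemma face_sections_hom:
  "ring_hom_ring (mpoly_ring k (carrier P)) (sections_ring k P) (face_sections k)"
proof (rule ring_hom_ringI2)
  have h: "(+>\<^bsub>mpoly_ring k (atoms P \<inter> \<aa>)\<^esub>) (SR_ideal k P \<aa>)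
      \<in> ring_hom (mpoly_ring k (atoms P \<inter> \<aa>)) (SR_ring k P \<aa>)" for \<aa>
    unfolding SR_ring_def by (rule ideal.rcos_ring_hom[OF ideal_SR_ideal])
  note closed = face_subst_closed[OF complex_in_max_intersections]
  show "face_sections k \<in> ring_hom (mpoly_ring k (carrier P)) (sections_ring k P)"
  proof (rule ring_hom_memI)
    fix f g
    show "face_sections k f \<in> carrier (sections_ring k P)" by (rule face_sections_closed)
    show "face_sections k (f \<otimes>\<^bsub>mpoly_ring k (carrier P)\<^esub> g) =
        face_sections k f \<otimes>\<^bsub>sections_ring k P\<^esub> face_sections k g"
      using ring_hom_mult[OF h closed closed]
      by (auto simp: face_sections_def sections_ring_def mpoly_ring_simps(2-) face_subst_simps
          intro!: restrict_ext)
    show "face_sections k (f \<oplus>\<^bsub>mpoly_ring k (carrier P)\<^esub> g) =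
        face_sections k f \<oplus>\<^bsub>sections_ring k P\<^esub> face_sections k g"
      using ring_hom_add[OF h closed closed]
      by (auto simp: face_sections_def sections_ring_def mpoly_ring_simps(2-) face_subst_simps
          intro!: restrict_ext)
  next
    show "face_sections k \<one>\<^bsub>mpoly_ring k (carrier P)\<^esub> = \<one>\<^bsub>sections_ring k P\<^esub>"
      using ring_hom_one[OF h]
      by (auto simp: face_sections_def sections_ring_def mpoly_ring_simps(2-) face_subst_simps
          intro!: restrict_ext)
  qed
qed (use ring_mpoly_ring cring_sections_ring[OF simplicial] cring.axioms(1) in blast)+

lemma face_sections_eq_zero_iff:
  "face_sections k f = \<zero>\<^bsub>sections_ring k P\<^esub> \<longleftrightarrow>
    (\<forall>\<aa>\<in>max_intersections P. face_subst \<aa> f \<in> SR_ideal k P \<aa>)"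
proof -
  have "SR_ideal k P \<aa> +>\<^bsub>mpoly_ring k (atoms P \<inter> \<aa>)\<^esub> face_subst \<aa> f = \<zero>\<^bsub>SR_ring k P \<aa>\<^esub> \<longleftrightarrow>
      face_subst \<aa> f \<in> SR_ideal k P \<aa>" if "\<aa> \<in> max_intersections P" for \<aa>
  proof -
    interpret I: ideal "SR_ideal k P \<aa>" "mpoly_ring k (atoms P \<inter> \<aa>)" by (rule ideal_SR_ideal)
    have closed: "face_subst \<aa> f \<in> carrier (mpoly_ring k (atoms P \<inter> \<aa>))"
      by (rule face_subst_closed[OF complex_in_max_intersections[OF that]])
    show ?thesis using I.a_rcos_const I.a_rcos_self[OF closed] by (auto simp: SR_ring_def FactRing_def)
  qed
  then show ?thesis by (auto simp: face_sections_def sections_ring_def fun_eq_iff restrict_def)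
qed

section \<open>Surjectivity onto the global sections\<close>

lemma maximal_above:
  assumes fin: "finite (carrier P)" and x: "x \<in> carrier P"
  obtains t where "t \<in> maximal_elements P (carrier P)" "x \<sqsubseteq> t"
proof -
  have "card (lower_interval P y) \<le> card (carrier P)" for y
    using fin by (intro card_mono) (auto simp: lower_interval_def)
  then obtain t where t: "t \<in> carrier P" "x \<sqsubseteq> t"
    and max: "\<And>y. y \<in> carrier P \<Longrightarrow> x \<sqsubseteq> y \<Longrightarrow> card (lower_interval P y) \<le> card (lower_interval P t)"
    using ex_has_greatest_nat[of "\<lambda>t. t \<in> carrier P \<and> x \<sqsubseteq> t" x "\<lambda>y. card (lower_interval P y)"
        "card (carrier P) + 1"] x by (auto simp: less_Suc_eq_le)
  have "y = t" if y: "y \<in> carrier P" "t \<sqsubseteq> y" for y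
    using max[OF y(1) le_trans[OF t(2) y(2) x t(1) y(1)]]
      lower_interval_mono_strict[OF t(1) y] by fastforce
  then show thesis using that t by (auto simp: maximal_elements_def)
qed

text \<open>The least member of X(P) containing \<open>x\<close>, for finite \<open>P\<close>. The
  coefficients that a section attaches to \<open>x\<close> are read off there and are then forced in
  every other cell containing \<open>x\<close>.\<close>

definition carrier_cell :: "'a \<Rightarrow> 'a set" where
  "carrier_cell x = ideal_meet P {t \<in> maximal_elements P (carrier P). x \<sqsubseteq> t}"

lemma carrier_cell:
  assumes "finite (carrier P)" "x \<in> carrier P"
  shows "carrier_cell x \<in> max_intersections P" "x \<in> carrier_cell x"
    "\<aa> \<in> max_intersections P \<Longrightarrow> x \<in> \<aa> \<Longrightarrow> carrier_cell x \<subseteq> \<aa>"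
proof -
  obtain t where "t \<in> maximal_elements P (carrier P)" "x \<sqsubseteq> t" by (rule maximal_above[OF assms])
  then show "carrier_cell x \<in> max_intersections P"
    by (auto simp: carrier_cell_def max_intersections_def)
  show "x \<in> carrier_cell x"
    using assms by (auto simp: carrier_cell_def ideal_meet_def lower_interval_def)
  assume "\<aa> \<in> max_intersections P" "x \<in> \<aa>"
  then obtain \<tau> where "\<aa> = ideal_meet P \<tau>" "\<tau> \<subseteq> maximal_elements P (carrier P)"
    by (auto simp: max_intersections_def)
  moreover from this \<open>x \<in> \<aa>\<close> have "\<tau> \<subseteq> {t \<in> maximal_elements P (carrier P). x \<sqsubseteq> t}"
    by (auto simp: ideal_meet_def lower_interval_def)
  ultimately show "carrier_cell x \<subseteq> \<aa>" by (auto simp: carrier_cell_def ideal_meet_def)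
qed

text \<open>A lift of the face monomial \<open>m\<close>: one copy of each atom of \<open>x\<close>
  is traded for the variable \<open>x\<close>. That variable makes the lift vanish on cells without
  \<open>x\<close>; a lift in the atoms alone could survive on a cell where a different face has the
  same atoms.\<close>

lemma face_subst_cell_monomial:
  assumes \<aa>: "complex_in \<aa>" and x: "x \<in> carrier P" and m: "keys m = vs x"
  shows "face_subst \<aa> (monomial (monomial x 1 + (m - ind (vs x))) c) =
    (if x \<in> \<aa> then monomial m c else 0)"
proof -
  have keys: "keys (m - ind (vs x)) \<subseteq> vs x"
    using keys_diff[of m "ind (vs x)"] by (auto simp: m keys_ind finite_vs[OF x])
  then have "expo (m - ind (vs x)) = m - ind (vs x)"
    by (intro expo_atoms) (auto simp: atoms_below_def)
  then have "expo (monomial x 1 + (m - ind (vs x))) = m"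
    using ind_keys_add[of m] by (simp add: expo_add expo_single m del: One_nat_def)
  moreover have "keys (monomial x 1 + (m - ind (vs x))) \<subseteq> \<aa> \<longleftrightarrow> x \<in> \<aa>"
    using keys complex_in_vs[OF \<aa>, of x] by (auto simp: keys_exponent_add)
  ultimately show ?thesis by (simp add: face_subst_monomial)
qed

lemma face_sections_surj:
  assumes fin: "finite (carrier P)"
  shows "face_sections k ` carrier (mpoly_ring k (carrier P)) = carrier (sections_ring k P)"
proof
  show "face_sections k ` carrier (mpoly_ring k (carrier P)) \<subseteq> carrier (sections_ring k P)"
    using face_sections_closed by blast
  show "carrier (sections_ring k P) \<subseteq> face_sections k ` carrier (mpoly_ring k (carrier P))"
  proof
    fix q assume q: "q \<in> carrier (sections_ring k P)"
    let ?X = "max_intersections P"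
    have qe: "q \<in> extensional ?X" and qc: "\<And>\<aa>. \<aa> \<in> ?X \<Longrightarrow> q \<aa> \<in> carrier (SR_ring k P \<aa>)"
      and qp: "\<And>\<aa> \<bb>. \<aa> \<in> ?X \<Longrightarrow> \<bb> \<in> ?X \<Longrightarrow> \<bb> \<subseteq> \<aa> \<Longrightarrow> SR_proj k P \<aa> \<bb> (q \<aa>) = q \<bb>"
      using q by (auto simp: sections_ring_def PiE_iff)
    have "\<forall>\<aa>\<in>?X. \<exists>f. f \<in> carrier (mpoly_ring k (atoms P \<inter> \<aa>)) \<and>
        q \<aa> = SR_ideal k P \<aa> +>\<^bsub>mpoly_ring k (atoms P \<inter> \<aa>)\<^esub> f"
      using qc unfolding SR_ring_carrier by blast
    then obtain h where h: "\<And>\<aa>. \<aa> \<in> ?X \<Longrightarrow> h \<aa> \<in> carrier (mpoly_ring k (atoms P \<inter> \<aa>))"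
      "\<And>\<aa>. \<aa> \<in> ?X \<Longrightarrow> q \<aa> = SR_ideal k P \<aa> +>\<^bsub>mpoly_ring k (atoms P \<inter> \<aa>)\<^esub> h \<aa>"
      by (metis (no_types, lifting))
    \<comment> \<open>The representatives \<open>h\<close> are chosen cell by cell. Compatibility of
      the section makes them agree on the face monomials of the smaller cell, though not necessarily
      elsewhere.\<close>
    have coherent: "lookup (h \<aa>) m = lookup (h \<bb>) m"
      if "\<aa> \<in> ?X" "\<bb> \<in> ?X" "\<bb> \<subseteq> \<aa>" "keys m \<in> vs ` \<bb>" for \<aa> \<bb> m
      using qp[OF that(1-3)] SR_proj_eq_iff[OF that(1-3) h(1)[OF that(1)] h(1)[OF that(2)]] that(4)
      unfolding h(2)[OF that(1)] h(2)[OF that(2)] by blast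
    \<comment> \<open>Each coefficient attached to \<open>x\<close> is lifted once, from the least
      cell containing \<open>x\<close>; reading it from every cell would count it
      repeatedly.\<close>
    define M where "M x = {m \<in> keys (h (carrier_cell x)). keys m = vs x}" for x
    define g where "g = (\<Sum>x\<in>carrier P. \<Sum>m\<in>M x.
      monomial (monomial x 1 + (m - ind (vs x))) (lookup (h (carrier_cell x)) m))"
    have "g \<in> carrier (mpoly_ring k (carrier P))"
      unfolding g_def
    proof (intro mpoly_sum_closed mpoly_single_closed)
      fix x m assume "x \<in> carrier P" "m \<in> M x"
      moreover from this have "keys (m - ind (vs x)) \<subseteq> vs x"
        using keys_diff[of m "ind (vs x)"] by (auto simp: M_def keys_ind finite_vs)
      ultimately show "keys (monomial x 1 + (m - ind (vs x))) \<subseteq> carrier P"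
        using atom_closed by (auto simp: keys_exponent_add atoms_below_def)
    qed
    moreover have "face_sections k g = q"
    proof (rule extensionalityI)
      fix \<aa> assume \<aa>: "\<aa> \<in> ?X"
      note c = complex_in_max_intersections[OF \<aa>]
      obtain t where t: "t \<in> carrier P" "\<And>x. x \<in> \<aa> \<Longrightarrow> x \<in> carrier P \<and> x \<sqsubseteq> t"
        using complex_inE[OF c] by blast
      have "lookup (face_subst \<aa> g) m = lookup (h \<aa>) m" if y: "y \<in> \<aa>" "keys m = vs y" for m y
      proof -
        have yP: "y \<in> carrier P" using t(2) y(1) by blast
        have "lookup (face_subst \<aa> g) m = (\<Sum>x\<in>carrier P. \<Sum>m'\<in>M x.
            lookup (if x \<in> \<aa> then monomial m' (lookup (h (carrier_cell x)) m') else 0) m)"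
          unfolding g_def face_subst_simps lookup_sum
          by (intro sum.cong HOL.refl) (simp add: M_def face_subst_cell_monomial[OF c] del: One_nat_def)
        also have "\<dots> = (\<Sum>x\<in>carrier P. if x = y then lookup (h (carrier_cell y)) m else 0)"
        proof (intro sum.cong HOL.refl)
          fix x assume x: "x \<in> carrier P"
          show "(\<Sum>m'\<in>M x. lookup (if x \<in> \<aa> then monomial m' (lookup (h (carrier_cell x)) m') else 0) m)
            = (if x = y then lookup (h (carrier_cell y)) m else 0)"
          proof (cases "x = y")
            case True
            have "(\<Sum>m'\<in>M y. lookup (monomial m' (lookup (h (carrier_cell y)) m')) m) =
               (\<Sum>m'\<in>M y. if m' = m then lookup (h (carrier_cell y)) m else 0)"
              by (intro sum.cong) (auto simp: lookup_single)
            also have "\<dots> = lookup (h (carrier_cell y)) m"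
              using y(2) by (simp add: M_def in_keys_iff)
            finally show ?thesis using True y(1) by simp
          next
            case False
            \<comment> \<open>Two faces below \<open>t\<close> with the same atoms coincide, so no
              other \<open>x\<close> in \<open>\<aa>\<close> contributes to
              \<open>m\<close>.\<close>
            have "m' \<noteq> m" if "m' \<in> M x" "x \<in> \<aa>" for m'
              using that False vs_inj[OF t(1)] t(2) y by (auto simp: M_def)
            then show ?thesis using False by (auto simp: lookup_single intro!: sum.neutral)
          qed
        qed
        also have "\<dots> = lookup (h (carrier_cell y)) m" using fin yP by simp
        \<comment> \<open>The least cell containing \<open>y\<close> is contained in
          \<open>\<aa>\<close>, so coherence transfers the coefficient.\<close>
        also have "\<dots> = lookup (h \<aa>) m"
          using coherent[OF \<aa> carrier_cell(1)[OF fin yP] carrier_cell(3)[OF fin yP \<aa> y(1)]]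
            carrier_cell(2)[OF fin yP] y(2) by auto
        finally show ?thesis .
      qed
      then show "face_sections k g \<aa> = q \<aa>"
        using SR_coset_eq_iff[OF c face_subst_closed[OF c] h(1)[OF \<aa>]] \<aa> h(2)[OF \<aa>]
        by (auto simp: face_sections_def)
    qed (use qe in \<open>auto simp: face_sections_def\<close>)
    ultimately show "q \<in> face_sections k ` carrier (mpoly_ring k (carrier P))" by blast
  qed
qed

section \<open>The relations of the face ring\<close>

lemma face_relation_closed:
  assumes p: "p \<in> carrier P" and q: "q \<in> carrier P"
  shows "face_relation P p q \<in> carrier (mpoly_ring k (carrier P))"
proof (cases "minimal_upper_bounds P p q = {}")
  case True
  then show ?thesis using p q by (simp add: face_relation_def mpoly_mult_closed mpoly_var_closed)
next
  case False
  then obtain z where "z \<in> minimal_upper_bounds P p q" by blast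
  then have "p \<sqsubseteq> z" "q \<sqsubseteq> z" "z \<in> carrier P" using mub_upper mub_closed p q by auto
  then have "p \<sqinter> q \<in> carrier P" using meet_props(1) p q by blast
  then show ?thesis
    using False p q mub_closed[of _ p q]
    by (auto simp: face_relation_def intro!: mpoly_diff_closed mpoly_mult_closed mpoly_sum_closed
        mpoly_var_closed)
qed

text \<open>If \<open>p\<close> or \<open>q\<close> is missing from \<open>\<aa>\<close>, so are all
  their upper bounds, and everything vanishes. Otherwise only their join \<open>z\<close> below
  \<open>t\<close> can lie in \<open>\<aa>\<close>. If it does, both terms have the same exponent,
  since indicators of a union and an intersection add up to those of the two sets. If it does not,
  the atoms of \<open>p\<close> and \<open>q\<close> together form a nonface.\<close>

lemma face_subst_face_relation:
  fixes k :: "'k::field itself"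
  assumes fin: "finite (carrier P)" and \<aa>: "complex_in \<aa>" and p: "p \<in> carrier P" and q: "q \<in> carrier P"
  shows "face_subst \<aa> (face_relation P p q) \<in> SR_ideal k P \<aa>"
proof -
  let ?u = "minimal_upper_bounds P p q"
  have zero: "0 \<in> SR_ideal k P \<aa>" by (rule mpoly_ideal_zero[OF ideal_SR_ideal])
  have finu: "finite ?u" using fin mub_closed[of _ p q] by (auto intro: finite_subset)
  show ?thesis
  proof (cases "p \<in> \<aa> \<and> q \<in> \<aa>")
    case False
    have "z \<notin> \<aa>" if "z \<in> ?u" for z
      using False complex_in_lower[OF \<aa>, of z] mub_upper[OF that p q] p q by blast
    then have "face_subst \<aa> (\<Sum>z\<in>?u. mvar z :: ('a, 'k) mpoly) = 0"
      by (simp add: face_subst_simps)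
    moreover have "face_subst \<aa> (mvar p * mvar q :: ('a, 'k) mpoly) = 0"
      using False by (auto simp: face_subst_simps)
    ultimately show ?thesis using zero
      by (simp add: face_relation_def face_subst_diff face_subst_simps(2))
  next
    case True
    obtain t where t: "t \<in> carrier P" "\<And>x. x \<in> \<aa> \<Longrightarrow> x \<in> carrier P \<and> x \<sqsubseteq> t"
      using complex_inE[OF \<aa>] by blast
    have pt: "p \<sqsubseteq> t" "q \<sqsubseteq> t" using True t(2) by auto
    obtain z where z: "?u \<inter> lower_interval P t = {z}" "vs z = vs p \<union> vs q"
      by (rule mub_below[OF p pt(1) q pt(2) t(1)])
    have zt: "z \<in> ?u" "z \<in> carrier P" "z \<sqsubseteq> t" using z(1) by (auto simp: lower_interval_def)
    have z_eq: "y = z" if "y \<in> ?u" "y \<in> \<aa>" for y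
      using that z(1) t(2)[of y] by (auto simp: lower_interval_def)
    note meet = meet_props[OF p pt(1) q pt(2) t(1)]
    have meet_mem: "p \<sqinter> q \<in> \<aa>" using complex_in_lower[OF \<aa> _ meet(1,2)] True by blast
    have "face_subst \<aa> (\<Sum>y\<in>?u. mvar y :: ('a, 'k) mpoly) =
        (\<Sum>y\<in>?u. if y = z then if z \<in> \<aa> then monomial (ind (vs z)) 1 else 0 else 0)"
      unfolding face_subst_simps(3)
    proof (intro sum.cong HOL.refl)
      fix y assume y: "y \<in> ?u"
      show "face_subst \<aa> (mvar y :: ('a, 'k) mpoly) =
          (if y = z then if z \<in> \<aa> then monomial (ind (vs z)) 1 else 0 else 0)"
        using z_eq[OF y] by (cases "y \<in> \<aa>") (auto simp: face_subst_simps(6))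
    qed
    also have "\<dots> = (if z \<in> \<aa> then monomial (ind (vs z)) 1 else 0)"
      using finu zt(1) by simp
    finally have rel: "face_subst \<aa> (face_relation P p q) =
        (monomial (ind (vs p) + ind (vs q)) 1 :: ('a, 'k) mpoly) -
        monomial (ind (vs (p \<sqinter> q))) 1 * (if z \<in> \<aa> then monomial (ind (vs z)) 1 else 0)"
      using zt(1) True meet_mem
      by (auto simp: face_relation_def face_subst_diff face_subst_simps(2,6) mult_single)
    have fins: "finite (vs p)" "finite (vs q)" "finite (vs z)" "finite (vs (p \<sqinter> q))"
      using finite_vs p q zt(2) meet(1) by auto
    show ?thesis
    proof (cases "z \<in> \<aa>")
      case True
      have "ind (vs p) + ind (vs q) = ind (vs (p \<sqinter> q)) + ind (vs z)"
        by (rule poly_mapping_eqI) (use fins in \<open>simp add: lookup_add lookup_ind meet(4) z(2)\<close>)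
      then show ?thesis using rel True zero by (simp add: mult_single)
    next
      case False
      have "vs z \<noteq> vs y" if "y \<in> \<aa>" for y
        using vs_inj[OF t(1) zt(2,3), of y] t(2)[OF that] that False by auto
      then have "vs z \<notin> vs ` \<aa>" by blast
      moreover have "keys (ind (vs p) + ind (vs q)) = vs z"
        using fins by (simp add: keys_exponent_add keys_ind z(2))
      moreover have "vs z \<subseteq> atoms P \<inter> \<aa>"
        using complex_in_vs[OF \<aa>] \<open>p \<in> \<aa> \<and> q \<in> \<aa>\<close> z(2) by blast
      ultimately show ?thesis
        using rel False by (simp add: SR_ideal_iff[OF \<aa>] mpoly_single_closed)
    qed
  qed
qed

lemma face_subst_zero_relation:
  "complex_in \<aa> \<Longrightarrow> face_subst \<aa> (mvar (zero_hat P) - 1) = 0"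
  using complex_in_zero by (simp add: face_subst_diff face_subst_simps(5,6) ind_def)

section \<open>Straightening\<close>

text \<open>These replace Stanley's basis of monomials supported on chains: straightening into them needs
  no termination order, and distinct ones have distinct images under \<^term>\<open>face_subst\<close>.\<close>

definition standard :: "('a \<Rightarrow>\<^sub>0 nat) set" where
  "standard = {monomial x 1 + e | x e. x \<in> carrier P \<and> keys e \<subseteq> vs x}"

lemma standardI: "x \<in> carrier P \<Longrightarrow> keys e \<subseteq> vs x \<Longrightarrow> monomial x 1 + e \<in> standard"
  unfolding standard_def by blast

lemma expo_standard:
  assumes "x \<in> carrier P" "keys e \<subseteq> vs x"
  shows "expo (monomial x 1 + e) = ind (vs x) + e" "keys (expo (monomial x 1 + e)) = vs x"
proof -
  show e: "expo (monomial x 1 + e) = ind (vs x) + e"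
    using expo_atoms[of e] assms by (auto simp: expo_add expo_single atoms_below_def simp del: One_nat_def)
  show "keys (expo (monomial x 1 + e)) = vs x"
    unfolding e using assms by (auto simp: keys_exponent_add keys_ind finite_vs)
qed

text \<open>Take a monomial \<open>n\<close> of \<open>g\<close> with face \<open>x\<close>, and the
  cell below a maximal \<open>t\<close> above \<open>x\<close>. There a face is determined by its
  atoms, so the support of \<open>expo n\<close> recovers \<open>x\<close>, and
  \<open>expo n\<close> then recovers \<open>e\<close>. Nothing else in \<open>g\<close> can cancel
  the image of \<open>n\<close>, whose support is a face, against membership in the Stanley-Reisner
  ideal.\<close>

lemma standard_independent:
  assumes fin: "finite (carrier P)" and g: "keys g \<subseteq> standard"
    and zero: "\<And>\<aa>. \<aa> \<in> max_intersections P \<Longrightarrow> face_subst \<aa> g \<in> SR_ideal k P \<aa>"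
  shows "g = 0"
proof (rule ccontr)
  assume "g \<noteq> 0"
  then obtain n where n: "n \<in> keys g" by (metis keys_eq_empty ex_in_conv)
  then obtain x e where x: "n = monomial x 1 + e" "x \<in> carrier P" "keys e \<subseteq> vs x"
    using g by (auto simp: standard_def)
  obtain t where t: "t \<in> maximal_elements P (carrier P)" "x \<sqsubseteq> t" by (rule maximal_above[OF fin x(2)])
  have tP: "t \<in> carrier P" using t(1) by (simp add: maximal_elements_def)
  let ?a = "lower_interval P t"
  have \<aa>: "?a \<in> max_intersections P" by (rule lower_interval_max_intersections[OF t(1)])
  note c = complex_in_max_intersections[OF \<aa>]
  have xa: "x \<in> ?a" using x t by (simp add: lower_interval_def)
  note ex = expo_standard[OF x(2,3), folded x(1)]
  have "n' = n" if n': "n' \<in> keys g" "keys n' \<subseteq> ?a" "expo n' = expo n" for n'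
  proof -
    obtain y e' where y: "n' = monomial y 1 + e'" "y \<in> carrier P" "keys e' \<subseteq> vs y"
      using g n'(1) by (auto simp: standard_def)
    note ey = expo_standard[OF y(2,3), folded y(1)]
    have "vs y = vs x" using ey(2) ex(2) n'(3) by simp
    moreover have "y \<in> ?a" using n'(2) y(1) by (auto simp: keys_exponent_add)
    ultimately have "y = x" using vs_inj[OF tP y(2) _ x(2) t(2)] by (simp add: lower_interval_def)
    then show ?thesis using ex(1) ey(1) n'(3) x(1) y(1) by simp
  qed
  moreover have "keys n \<subseteq> ?a" using x xa complex_in_vs[OF c xa] by (auto simp: keys_exponent_add)
  ultimately have "{n' \<in> keys g. keys n' \<subseteq> ?a \<and> expo n' = expo n} = {n}" using n by blast
  then have "lookup (face_subst ?a g) (expo n) = lookup g n" by (simp add: lookup_face_subst)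
  then have "expo n \<in> keys (face_subst ?a g)" using n by (simp add: in_keys_iff)
  then show False using zero[OF \<aa>] SR_ideal_iff[OF c] ex(2) xa by blast
qed

text \<open>Modulo the relations, a variable \<open>w\<close> standing next to some \<open>z\<close>
  above it may be replaced by the product of its atoms. The induction splits an atom
  \<open>v\<close> off \<open>w\<close>, leaving \<open>w'\<close>. The relation for
  \<open>v\<close> and \<open>w'\<close> yields the sum of their minimal upper bounds, and
  multiplication by \<open>z\<close> kills all of these except \<open>w\<close>.\<close>

lemma absorb:
  fixes K :: "('a, 'k::field) mpoly set"
  assumes fin: "finite (carrier P)" and K: "ideal K (mpoly_ring k (carrier P))"
    and K0: "mvar (zero_hat P) - 1 \<in> K"
    and Krel: "\<And>p q. p \<in> carrier P \<Longrightarrow> q \<in> carrier P \<Longrightarrow> \<not> p \<sqsubseteq> q \<Longrightarrow> \<not> q \<sqsubseteq> p \<Longrightarrow> face_relation P p q \<in> K"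
    and z: "z \<in> carrier P" and w: "w \<in> carrier P" "w \<sqsubseteq> z"
  shows "mvar z * mvar w - mvar z * monomial (ind (vs w)) 1 \<in> K"
  using w
proof (induction "card (vs w)" arbitrary: w rule: less_induct)
  case less
  note wP = less.prems(1) and wz = less.prems(2)
  note K_mult = mpoly_ideal_mult[OF K] and K_diff = mpoly_ideal_diff[OF K]
    and K_add = mpoly_ideal_add[OF K] and K_uminus = mpoly_ideal_uminus[OF K]
  note var = mpoly_var_closed
  have w_eq: "w = y" if "y \<in> carrier P" "y \<sqsubseteq> s" "w \<sqsubseteq> s" "s \<in> carrier P" "vs w = vs y" for y s
    using vs_inj[OF that(4) wP that(3) that(1,2,5)] .
  show ?case
  proof (cases "vs w = {}")
    case True
    then have "w = zero_hat P" using w_eq[OF zero_closed zero_le[OF wP] le_refl[OF wP] wP] by simp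
    then show ?thesis using K_mult[OF K0 var[OF z]] by (simp add: ind_def algebra_simps)
  next
    case False
    then obtain v where v: "v \<in> vs w" by blast
    then have va: "v \<in> atoms P" "v \<in> carrier P" "v \<sqsubseteq> w" by (auto simp: atoms_below_def atoms_def)
    \<comment> \<open>The case of a single atom stands apart: there \<open>w'\<close> would be zero,
      which is comparable with \<open>v\<close>, so no relation would be available.\<close>
    show ?thesis
    proof (cases "vs w = {v}")
      case True
      then have "w = v" using w_eq[OF va(2,3) le_refl[OF wP] wP] vs_atom[OF va(1)] by simp
      then have "monomial (ind (vs w)) 1 = (mvar w :: ('a, 'k) mpoly)"
        using True by (simp add: ind_def mvar_def)
      then show ?thesis using mpoly_ideal_zero[OF K] by simp
    next
      case nv: False
      obtain w' where w': "w' \<in> carrier P" "w' \<sqsubseteq> w" "vs w' = vs w - {v}"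
        using vs_surj[OF wP, of "vs w - {v}"] by blast
      have w'z: "w' \<sqsubseteq> z" by (rule le_trans[OF w'(2) wz w'(1) wP z])
      have vz: "v \<sqsubseteq> z" by (rule le_trans[OF va(3) wz va(2) wP z])
      have "\<not> v \<sqsubseteq> w'" using w'(3) va(1) by (auto simp: atoms_below_def)
      moreover have "\<not> w' \<sqsubseteq> v"
        using vs_mono[OF _ w'(1) va(2)] vs_atom[OF va(1)] w'(3) v nv by auto
      ultimately have rel: "face_relation P v w' \<in> K" using Krel[OF va(2) w'(1)] by blast
      let ?u = "minimal_upper_bounds P v w'"
      obtain y0 where y0: "?u \<inter> lower_interval P z = {y0}" "vs y0 = vs v \<union> vs w'"
        by (rule mub_below[OF va(2) vz w'(1) w'z z])
      have vsw: "vs w = vs v \<union> vs w'" using vs_atom[OF va(1)] v w'(3) by auto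
      have "y0 \<in> carrier P" "y0 \<sqsubseteq> z" using y0(1) by (auto simp: lower_interval_def)
      then have "y0 = w" using w_eq[of y0 z] wz z vsw y0(2) by simp
      then have u: "?u \<inter> lower_interval P z = {w}" using y0(1) by simp
      then have wu: "w \<in> ?u" by blast
      have finu: "finite ?u" using fin mub_closed[of _ v w'] by (auto intro: finite_subset)
      note meet = meet_props[OF va(2) vz w'(1) w'z z]
      have "vs (v \<sqinter> w') = vs (zero_hat P)" using meet(4) vs_atom[OF va(1)] w'(3) by auto
      \<comment> \<open>As \<open>v\<close> and \<open>w'\<close> share no atom, the factor in front
        of the sum is the variable of zero, which \<open>K0\<close> later replaces by 1.\<close>
      then have meet0: "v \<sqinter> w' = zero_hat P"
        using vs_inj[OF va(2) meet(1,2) zero_closed zero_le[OF va(2)]] by simp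
      define \<Sigma> where "\<Sigma> = (\<Sum>y\<in>?u. mvar y :: ('a, 'k) mpoly)"
      have rel_eq: "face_relation P v w' = mvar v * mvar w' - mvar (zero_hat P) * \<Sigma>"
        using wu meet0 by (auto simp: face_relation_def \<Sigma>_def)
      \<comment> \<open>A common upper bound of \<open>y\<close> and \<open>z\<close> would lie
        above both \<open>y\<close> and \<open>w\<close>, which have the same atoms, forcing
        \<open>y = w\<close>. So the relation for \<open>y\<close> and \<open>z\<close> is their
        bare product.\<close>
      have other: "mvar z * mvar y \<in> K" if y: "y \<in> ?u" "y \<noteq> w" for y
      proof -
        have yP: "y \<in> carrier P" by (rule mub_closed[OF y(1)])
        have vsy: "vs w = vs y" using vs_mub[OF y(1) va(2) w'(1)] vsw by simp
        have no_ub: "\<not> (y \<sqsubseteq> s \<and> z \<sqsubseteq> s)" if "s \<in> carrier P" for s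
          using w_eq[OF yP _ le_trans[OF wz _ wP z that] that vsy] y(2) by blast
        have "mvar y * mvar z = (face_relation P y z :: ('a, 'k) mpoly)"
        proof -
          have "minimal_upper_bounds P y z = {}"
            using no_ub mub_closed mub_upper[OF _ yP z] by blast
          then show ?thesis by (simp add: face_relation_def)
        qed
        then show ?thesis
          using Krel[OF yP z] no_ub[OF z] no_ub[OF yP] le_refl[OF yP] le_refl[OF z]
          by (auto simp: mult.commute)
      qed
      have \<Sigma>_split: "\<Sigma> = mvar w + (\<Sum>y\<in>?u - {w}. mvar y)"
        unfolding \<Sigma>_def using finu wu by (rule sum.remove)
      have \<Sigma>_closed: "\<Sigma> \<in> carrier (mpoly_ring k (carrier P))"
        unfolding \<Sigma>_def using mub_closed by (intro mpoly_sum_closed var)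
      have "card (vs w') < card (vs w)"
        unfolding w'(3) using finite_vs[OF wP] v by (rule card_Diff1_less)
      then have IH: "mvar z * mvar w' - mvar z * monomial (ind (vs w')) 1 \<in> K"
        by (rule less.hyps[OF _ w'(1) w'z])
      have ind_eq: "(monomial (ind (vs w)) 1 :: ('a, 'k) mpoly) = mvar v * monomial (ind (vs w')) 1"
      proof -
        have "ind (vs w) = monomial v 1 + ind (vs w')"
          using finite_vs[OF wP] v unfolding ind_def w'(3) by (rule sum.remove)
        then show ?thesis by (simp add: mvar_def mult_single)
      qed
      have "(\<Sum>y\<in>?u - {w}. mvar z * mvar y) \<in> K"
        using other by (intro mpoly_ideal_sum[OF K]) blast
      moreover have "(mvar z * \<Sigma>) * (mvar (zero_hat P) - 1) \<in> K"
        by (intro K_mult K0 mpoly_mult_closed var z \<Sigma>_closed)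
      moreover have "mvar z * (mvar v * mvar w' - mvar (zero_hat P) * \<Sigma>) \<in> K"
        using K_mult[OF rel var[OF z]] unfolding rel_eq .
      moreover have "mvar v * (mvar z * mvar w' - mvar z * monomial (ind (vs w')) 1) \<in> K"
        by (intro K_mult IH var va)
      \<comment> \<open>The induction hypothesis times \<open>v\<close>, less the relation times
        \<open>z\<close>, less the correction for the variable of zero, less the killed terms:
        everything cancels down to the claim.\<close>
      ultimately have "mvar v * (mvar z * mvar w' - mvar z * monomial (ind (vs w')) 1) -
          mvar z * (mvar v * mvar w' - mvar (zero_hat P) * \<Sigma>) -
          (mvar z * \<Sigma>) * (mvar (zero_hat P) - 1) - (\<Sum>y\<in>?u - {w}. mvar z * mvar y) \<in> K"
        by (intro K_diff)
      also have "mvar v * (mvar z * mvar w' - mvar z * monomial (ind (vs w')) 1) -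
          mvar z * (mvar v * mvar w' - mvar (zero_hat P) * \<Sigma>) -
          (mvar z * \<Sigma>) * (mvar (zero_hat P) - 1) - (\<Sum>y\<in>?u - {w}. mvar z * mvar y) =
          mvar z * mvar w - mvar z * monomial (ind (vs w)) 1"
        unfolding ind_eq \<Sigma>_split sum_distrib_left[symmetric] by (simp add: algebra_simps)
      finally show ?thesis .
    qed
  qed
qed

text \<open>The set \<open>Sp\<close> of polynomials congruent to a standard combination contains
  the constants and is closed under sums and under multiplication by variables, so it contains every
  polynomial. \<open>K\<close> is any ideal containing the relations; it will be the kernel of the
  map onto the face ring.\<close>

lemma standard_spans:
  fixes K :: "('a, 'k::field) mpoly set"
  assumes fin: "finite (carrier P)" and K: "ideal K (mpoly_ring k (carrier P))"
    and K0: "mvar (zero_hat P) - 1 \<in> K"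
    and Krel: "\<And>p q. p \<in> carrier P \<Longrightarrow> q \<in> carrier P \<Longrightarrow> \<not> p \<sqsubseteq> q \<Longrightarrow> \<not> q \<sqsubseteq> p \<Longrightarrow> face_relation P p q \<in> K"
    and f: "f \<in> carrier (mpoly_ring k (carrier P))"
  obtains g where "keys g \<subseteq> standard" "f - g \<in> K"
proof -
  note K_mult = mpoly_ideal_mult[OF K] and K_add = mpoly_ideal_add[OF K]
  note var = mpoly_var_closed
  define Sp where "Sp = {f :: ('a, 'k) mpoly. \<exists>g. keys g \<subseteq> standard \<and> f - g \<in> K}"
  have Sp_cong: "f \<in> Sp" if "f - g \<in> K" "g \<in> Sp" for f g
  proof -
    obtain h where "keys h \<subseteq> standard" "g - h \<in> K" using \<open>g \<in> Sp\<close> by (auto simp: Sp_def)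
    then show ?thesis using K_add[OF that(1), of "g - h"] by (auto simp: Sp_def)
  qed
  have Sp_standard: "g \<in> Sp" if "keys g \<subseteq> standard" for g
    using that mpoly_ideal_zero[OF K] by (auto simp: Sp_def)
  have Sp_sum: "sum h A \<in> Sp" if "\<And>i. i \<in> A \<Longrightarrow> h i \<in> Sp" for h :: "'i \<Rightarrow> ('a, 'k) mpoly" and A
  proof -
    have "\<forall>i\<in>A. \<exists>g. keys g \<subseteq> standard \<and> h i - g \<in> K" using that by (simp add: Sp_def)
    from bchoice[OF this] obtain g
      where g: "\<forall>i\<in>A. keys (g i) \<subseteq> standard \<and> h i - g i \<in> K" by blast
    then have "sum h A - sum g A \<in> K"
      unfolding sum_subtractf[symmetric] by (intro mpoly_ideal_sum[OF K]) blast
    moreover have "keys (sum g A) \<subseteq> standard" using keys_sum[of g A] g by blast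
    ultimately show ?thesis by (auto simp: Sp_def)
  qed
  note absorb = absorb[OF fin K K0 Krel]
  \<comment> \<open>After absorption only the face variable \<open>z\<close> remains besides atoms
    of \<open>z\<close>, which is a standard monomial.\<close>
  have Sp_absorbed: "mvar z * mvar w * monomial e c \<in> Sp"
    if z: "z \<in> carrier P" and w: "w \<in> carrier P" "w \<sqsubseteq> z" and e: "keys e \<subseteq> vs z" for z w e c
  proof (rule Sp_cong)
    have e': "keys e \<subseteq> carrier P" using e atom_closed by (auto simp: atoms_below_def)
    have "monomial e c * (mvar z * mvar w - mvar z * monomial (ind (vs w)) 1) \<in> K"
      using absorb[OF _ _ _ _ z w] by (intro K_mult mpoly_single_closed e') auto
    then show "mvar z * mvar w * monomial e c - monomial (monomial z 1 + (ind (vs w) + e)) c \<in> K"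
      by (simp add: mvar_def mult_single algebra_simps)
    have "keys (ind (vs w) + e) \<subseteq> vs z"
      using e vs_mono[OF w(2,1) z] finite_vs[OF w(1)] by (auto simp: keys_exponent_add keys_ind)
    then show "monomial (monomial z 1 + (ind (vs w) + e)) c \<in> Sp"
      using standardI[OF z] by (intro Sp_standard) auto
  qed
  have Sp_var_standard: "mvar p * monomial n c \<in> Sp" if p: "p \<in> carrier P" and n: "n \<in> standard" for p n c
  proof -
    obtain x e where x: "n = monomial x 1 + e" "x \<in> carrier P" "keys e \<subseteq> vs x"
      using n by (auto simp: standard_def)
    have e': "keys e \<subseteq> carrier P" using x(3) atom_closed by (auto simp: atoms_below_def)
    have n_eq: "monomial n c = mvar x * monomial e c" by (simp add: x(1) mvar_def mult_single)
    consider "p \<sqsubseteq> x" | "x \<sqsubseteq> p" | "\<not> p \<sqsubseteq> x" "\<not> x \<sqsubseteq> p" by blast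
    then show ?thesis
    proof cases
      case 1
      then show ?thesis using Sp_absorbed[OF x(2) p _ x(3), of c] by (simp add: n_eq algebra_simps)
    next
      case 2
      then show ?thesis using Sp_absorbed[OF p x(2) 2, of e c] x(3) vs_mono[OF 2 x(2) p]
        by (simp add: n_eq algebra_simps)
    next
      case 3
      let ?u = "minimal_upper_bounds P p x"
      \<comment> \<open>One use of the relation suffices: each \<open>z\<close> lies above
        \<open>x\<close>, hence above the atoms in \<open>e\<close>, and it absorbs the
        meet.\<close>
      have "mvar z * mvar (p \<sqinter> x) * monomial e c \<in> Sp" if z: "z \<in> ?u" for z
      proof -
        have zP: "z \<in> carrier P" and le: "p \<sqsubseteq> z" "x \<sqsubseteq> z"
          using mub_closed[OF z] mub_upper[OF z p x(2)] by auto
        note meet = meet_props[OF p le(1) x(2) le(2) zP]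
        show ?thesis
          using Sp_absorbed[OF zP meet(1) le_trans[OF meet(2) le(1) meet(1) p zP], of e c]
            vs_mono[OF le(2) x(2) zP] x(3) by blast
      qed
      then have "(\<Sum>z\<in>?u. mvar z * mvar (p \<sqinter> x) * monomial e c) \<in> Sp" by (rule Sp_sum)
      moreover have "monomial e c * face_relation P p x \<in> K"
        by (intro K_mult Krel p x 3 mpoly_single_closed e')
      moreover have "monomial e c * face_relation P p x =
          mvar p * monomial n c - (\<Sum>z\<in>?u. mvar z * mvar (p \<sqinter> x) * monomial e c)"
        by (cases "?u = {}")
          (simp_all add: face_relation_def n_eq algebra_simps sum_distrib_left sum_distrib_right)
      ultimately show ?thesis using Sp_cong by metis
    qed
  qed
  have Sp_var: "mvar p * f \<in> Sp" if p: "p \<in> carrier P" and f: "f \<in> Sp" for p f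
  proof -
    obtain g where g: "keys g \<subseteq> standard" "f - g \<in> K" using f by (auto simp: Sp_def)
    have g_eq: "mvar p * g = (\<Sum>n\<in>keys g. mvar p * monomial n (lookup g n))"
      by (subst mpoly_monomials[of g]) (rule sum_distrib_left)
    have "mvar p * g \<in> Sp"
      unfolding g_eq by (intro Sp_sum Sp_var_standard p subsetD[OF g(1)])
    moreover have "mvar p * f - mvar p * g \<in> K"
      using K_mult[OF g(2) var[OF p]] by (simp add: algebra_simps)
    ultimately show ?thesis using Sp_cong by blast
  qed
  have Sp_power: "mvar p ^ j * f \<in> Sp" if "p \<in> carrier P" "f \<in> Sp" for p j f
    using that by (induction j) (auto simp: mult.assoc intro: Sp_var)
  have Sp_prod: "(\<Prod>p\<in>A. mvar p ^ j p) * f \<in> Sp" if "A \<subseteq> carrier P" "f \<in> Sp" for A j f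
    using that by (induction A rule: infinite_finite_induct) (auto simp: mult.assoc intro: Sp_power)
  \<comment> \<open>A standard monomial always carries a face variable, so a constant is represented
    with the variable of zero.\<close>
  have "mconst c \<in> Sp" for c
  proof (rule Sp_cong)
    have "monomial (monomial (zero_hat P) 1) c \<in> Sp"
      using standardI[OF zero_closed, of 0] by (intro Sp_standard) auto
    then show "mconst c * mvar (zero_hat P) \<in> Sp"
      by (simp add: mconst_def mvar_def mult_single)
    show "mconst c - mconst c * mvar (zero_hat P) \<in> K"
      using K_mult[OF mpoly_ideal_uminus[OF K K0] mpoly_const_closed[of c]] by (simp add: algebra_simps)
  qed
  then have "monomial n c \<in> Sp" if "keys n \<subseteq> carrier P" for n c
    using Sp_prod[OF that, of "mconst c" "lookup n"]
    unfolding prod_mvar_power by (simp add: mult.commute mconst_mult_monomial)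
  then have "(\<Sum>n\<in>keys f. monomial n (lookup f n)) \<in> Sp"
    using f by (intro Sp_sum) (auto simp: mpoly_ring_simps)
  then have "f \<in> Sp" by (simp flip: mpoly_monomials)
  then show thesis using that by (auto simp: Sp_def)
qed

section \<open>The isomorphism\<close>

text \<open>Both rings are images of the same polynomial ring, so it suffices that the two kernels
  \<open>?K\<close> and \<open>?L\<close> agree.\<close>

lemma sections_ring_iso_face_ring:
  fixes k :: "'k::field itself"
  assumes fin: "finite (carrier P)"
  shows "sections_ring k P \<simeq> face_ring k P"
proof -
  let ?R = "mpoly_ring k (carrier P)" and ?S = "face_base_ring k P" and ?F = "face_ring k P"
  let ?B = "face_base_ideal k P" and ?J = "face_ideal k P"
  have z_closed: "{mvar (zero_hat P) - 1} \<subseteq> carrier ?R"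
    using mpoly_diff_closed[OF mpoly_var_closed[OF zero_closed] mpoly_one_closed] by simp
  interpret B: ideal ?B ?R
    unfolding face_base_ideal_def by (rule ring.genideal_ideal[OF ring_mpoly_ring z_closed])
  interpret \<rho>: ring_hom_ring ?R ?S "(+>\<^bsub>?R\<^esub>) ?B"
    unfolding face_base_ring_def by (rule B.rcos_ring_hom_ring)
  let ?rel = "{?B +>\<^bsub>?R\<^esub> face_relation P p q | p q.
      p \<in> carrier P \<and> q \<in> carrier P \<and> \<not> p \<sqsubseteq> q \<and> \<not> q \<sqsubseteq> p}"
  have rel_closed: "?rel \<subseteq> carrier ?S"
    using \<rho>.hom_closed[OF face_relation_closed] by blast
  interpret J: ideal ?J ?S
    unfolding face_ideal_def by (rule \<rho>.S.genideal_ideal[OF rel_closed])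
  interpret \<sigma>: ring_hom_ring ?S ?F "(+>\<^bsub>?S\<^esub>) ?J"
    unfolding face_ring_def by (rule J.rcos_ring_hom_ring)
  \<comment> \<open>The face ring is a quotient of a quotient; the composite map exhibits it as one
    quotient of the polynomial ring.\<close>
  define \<psi> where "\<psi> f = ?J +>\<^bsub>?S\<^esub> (?B +>\<^bsub>?R\<^esub> f)" for f
  interpret \<psi>: ring_hom_ring ?R ?F \<psi>
  proof (rule ring_hom_ringI2[OF ring_mpoly_ring cring.axioms(1)[OF cring_face_ring[OF simplicial]]])
    show "\<psi> \<in> ring_hom ?R ?F"
      using ring_hom_trans[OF \<rho>.homh \<sigma>.homh] by (simp add: \<psi>_def[abs_def] comp_def)
  qed
  have \<psi>_zero_iff: "\<psi> f = \<zero>\<^bsub>?F\<^esub> \<longleftrightarrow> ?B +>\<^bsub>?R\<^esub> f \<in> ?J" if "f \<in> carrier ?R" for f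
  proof -
    have zero: "\<zero>\<^bsub>?F\<^esub> = ?J" unfolding face_ring_def FactRing_def ring.simps ..
    have self: "?B +>\<^bsub>?R\<^esub> f \<in> \<psi> f" unfolding \<psi>_def by (rule J.a_rcos_self[OF \<rho>.hom_closed[OF that]])
    show ?thesis
    proof
      assume "\<psi> f = \<zero>\<^bsub>?F\<^esub>"
      then show "?B +>\<^bsub>?R\<^esub> f \<in> ?J" using self unfolding zero by (rule subst)
    next
      assume "?B +>\<^bsub>?R\<^esub> f \<in> ?J"
      then show "\<psi> f = \<zero>\<^bsub>?F\<^esub>" unfolding \<psi>_def zero by (rule J.a_rcos_const)
    qed
  qed
  have surj: "\<psi> ` carrier ?R = carrier ?F"
  proof -
    have "carrier ?F = (+>\<^bsub>?S\<^esub>) ?J ` carrier ?S"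
      unfolding face_ring_def FactRing_def A_RCOSETS_def' partial_object.simps by blast
    moreover have "carrier ?S = (+>\<^bsub>?R\<^esub>) ?B ` carrier ?R"
      unfolding face_base_ring_def FactRing_def A_RCOSETS_def' partial_object.simps by blast
    ultimately show ?thesis unfolding \<psi>_def by (simp only: image_image)
  qed
  interpret \<phi>: ring_hom_ring ?R "sections_ring k P" "face_sections k" by (rule face_sections_hom)
  let ?K = "a_kernel ?R ?F \<psi>" and ?L = "a_kernel ?R (sections_ring k P) (face_sections k)"
  have K: "ideal ?K ?R" and L: "ideal ?L ?R" by (rule \<psi>.kernel_is_ideal, rule \<phi>.kernel_is_ideal)
  have L_iff: "f \<in> ?L \<longleftrightarrow> f \<in> carrier ?R \<and> (\<forall>\<aa>\<in>max_intersections P. face_subst \<aa> f \<in> SR_ideal k P \<aa>)" for f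
    unfolding a_kernel_def' face_sections_eq_zero_iff by blast
  have K_iff: "f \<in> ?K \<longleftrightarrow> f \<in> carrier ?R \<and> ?B +>\<^bsub>?R\<^esub> f \<in> ?J" for f
    unfolding a_kernel_def' using \<psi>_zero_iff by blast
  have B_subset_L: "?B \<subseteq> ?L"
    unfolding face_base_ideal_def
  proof (rule ring.genideal_minimal[OF ring_mpoly_ring L])
    show "{mvar (zero_hat P) - 1} \<subseteq> ?L"
      using z_closed unfolding insert_subset L_iff
      by (simp add: face_subst_zero_relation[OF complex_in_max_intersections]
          mpoly_ideal_zero[OF ideal_SR_ideal])
  qed
  \<comment> \<open>\<open>?J\<close> is an ideal of the intermediate quotient, so \<open>?L\<close>
    is compared with it through its image there.\<close>
  have J_subset: "?J \<subseteq> (+>\<^bsub>?R\<^esub>) ?B ` ?L"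
    unfolding face_ideal_def
  proof (rule \<rho>.S.genideal_minimal)
    show "ideal ((+>\<^bsub>?R\<^esub>) ?B ` ?L) ?S"
      unfolding face_base_ring_def by (rule ring.ring_ideal_imp_quot_ideal[OF ring_mpoly_ring B.ideal_axioms L])
    have "face_relation P p q \<in> ?L" if "p \<in> carrier P" "q \<in> carrier P" for p q
      unfolding L_iff
      using face_relation_closed[OF that] face_subst_face_relation[OF fin complex_in_max_intersections that]
      by blast
    then show "?rel \<subseteq> (+>\<^bsub>?R\<^esub>) ?B ` ?L" by blast
  qed
  have K_subset_L: "?K \<subseteq> ?L"
  proof
    fix f assume "f \<in> ?K"
    then have f: "f \<in> carrier ?R" "?B +>\<^bsub>?R\<^esub> f \<in> ?J" unfolding K_iff by blast+
    then obtain g where g: "g \<in> ?L" "?B +>\<^bsub>?R\<^esub> f = ?B +>\<^bsub>?R\<^esub> g" using J_subset by blast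
    \<comment> \<open>Equal cosets give \<open>f\<close> and \<open>g\<close> equal only up to
      \<open>?B\<close>, which is harmless because \<open>?B\<close> lies in
      \<open>?L\<close>.\<close>
    have "f - g \<in> ?B"
      using mpoly_coset_eq_iff[OF B.ideal_axioms f(1)] g unfolding L_iff by blast
    then have "g + (f - g) \<in> ?L" using B_subset_L by (intro mpoly_ideal_add[OF L g(1)]) blast
    then show "f \<in> ?L" unfolding add_diff_cancel_left' diff_add_cancel add.commute[of g] .
  qed
  have "?L \<subseteq> ?K"
  proof
    fix f assume f: "f \<in> ?L"
    have K0: "mvar (zero_hat P) - 1 \<in> ?K"
    proof -
      have "mvar (zero_hat P) - 1 \<in> ?B"
        unfolding face_base_ideal_def using ring.genideal_self[OF ring_mpoly_ring z_closed] by blast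
      then have "?B +>\<^bsub>?R\<^esub> (mvar (zero_hat P) - 1) = ?B" by (rule B.a_rcos_const)
      also have "\<dots> = \<zero>\<^bsub>?S\<^esub>" unfolding face_base_ring_def FactRing_def ring.simps ..
      also have "\<dots> \<in> ?J" by (rule additive_subgroup.zero_closed[OF J.is_additive_subgroup])
      finally show ?thesis using z_closed unfolding K_iff by blast
    qed
    have Krel: "face_relation P p q \<in> ?K"
      if "p \<in> carrier P" "q \<in> carrier P" "\<not> p \<sqsubseteq> q" "\<not> q \<sqsubseteq> p" for p q
    proof -
      have "?B +>\<^bsub>?R\<^esub> face_relation P p q \<in> ?J"
        unfolding face_ideal_def
        by (rule subsetD[OF \<rho>.S.genideal_self[OF rel_closed]]) (use that in blast)
      then show ?thesis unfolding K_iff using face_relation_closed[OF that(1,2)] by blast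
    qed
    have f_closed: "f \<in> carrier ?R" using f unfolding L_iff by blast
    \<comment> \<open>Straighten \<open>f\<close> modulo \<open>?K\<close>. As \<open>?K\<close>
      lies in \<open>?L\<close>, the standard remainder \<open>g\<close> is in \<open>?L\<close>,
      and independence makes it zero.\<close>
    obtain g where g: "keys g \<subseteq> standard" "f - g \<in> ?K"
      by (rule standard_spans[OF fin K K0 Krel f_closed]) assumption
    have "f - g \<in> ?L" by (rule subsetD[OF K_subset_L g(2)])
    from mpoly_ideal_diff[OF L f this] have "g \<in> ?L"
      unfolding diff_diff_eq2 add_diff_cancel_left' .
    then have "g = 0" unfolding L_iff by (intro standard_independent[OF fin g(1), of k]) blast
    then show "f \<in> ?K" using g(2) by (simp only: diff_zero)
  qed
  then have "?K = ?L" using K_subset_L by blast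
  then have "?R Quot ?L \<simeq> ?F" using \<psi>.FactRing_iso[OF surj] by (rule subst)
  moreover have "sections_ring k P \<simeq> ?R Quot ?L"
    by (rule ring_iso_sym[OF ideal.quotient_is_ring[OF L] \<phi>.FactRing_iso[OF face_sections_surj[OF fin]]])
  ultimately show ?thesis by (rule ring_iso_trans[rotated])
qed

end

theorem theorem1:
  fixes P :: "('a, 'b) gorder_scheme" and k :: "'k::field itself"
  assumes "simplicial_poset P" and "finite (carrier P)"
  shows "sections_ring k P \<simeq> face_ring k P"
proof -
  interpret simplicial P
    using assms(1) by (simp add: simplicial_def simplicial_axioms_def simplicial_poset_def)
  show ?thesis by (rule sections_ring_iso_face_ring[OF assms(2)])
qed

end
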